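(* Let $S\subset\mathbb{R}^2$ be the following set (the "snake"), equipped with the Euclidean metric. Using polar coordinates $(r,\alpha)$, which denote the point $(r\cos\alpha, r\sin\alpha)$, put for every integer $n\ge 1$ $$O_n=\Big\{\Big(\tfrac1n,\alpha\Big):\ \alpha\in\Big(\tfrac{\pi}{2},2\pi\Big]\Big\},\qquad I_n=\Big\{(r,\alpha_n):\ r\in\Big[\tfrac1{n+1},\tfrac1n\Big]\Big\},$$ where $\alpha_n=\frac{\pi}{2}$ if $n$ is odd and $\alpha_n=0$ if $n$ is even, and let $$S=\{(0,0)\}\cup\bigcup_{n=1}^{\infty}(O_n\cup I_n).$$ Then $S$ is an arc (i.e. homeomorphic to $[0,1]$), $S$ is a weak IFS-attractor, $S$ is a Banach fractal, and $S$ is not an IFS-attractor.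
   Context: An IFS (iterated function system) on a metric space $(X,d)$ is a finite family $\mathcal{F}$ of maps $X\to X$ each having Lipschitz constant strictly less than $1$. The attractor of $\mathcal{F}$ is the unique nonempty compact set $A\subset X$ with $A=\bigcup_{f\in\mathcal{F}}f(A)$. A weak IFS on $(X,d)$ is a finite family $\mathcal{F}$ of maps $f:X\to X$ that are weak contractions, i.e. $d(f(x),f(y))<d(x,y)$ for all distinct $x,y\in X$. A nonempty compact set $A\subset X$ with $A=\bigcup_{f\in\mathcal{F}}f(A)$ is called an attractor of the weak IFS. A compact metric space $A$ is called an IFS-attractor (respectively a weak IFS-attractor) if $A$ is the attractor of some IFS (respectively an attractor of some weak IFS) on some metric space $X$ which contains $A$ as a metric subspace (with the given metric of $A$). A Banach fractal is a compact metrizable space which is homeomorphic to the attractor of an IFS on a complete metric space. *)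

theory Defs
  imports "HOL-Analysis.Analysis"
begin

definition contraction :: "'a metric \<Rightarrow> ('a \<Rightarrow> 'a) \<Rightarrow> bool" where
  "contraction X f \<longleftrightarrow> f \<in> mspace X \<rightarrow> mspace X \<and>
     (\<exists>c. 0 \<le> c \<and> c < 1 \<and>
        (\<forall>x\<in>mspace X. \<forall>y\<in>mspace X. mdist X (f x) (f y) \<le> c * mdist X x y))"

definition weak_contraction :: "'a metric \<Rightarrow> ('a \<Rightarrow> 'a) \<Rightarrow> bool" where
  "weak_contraction X f \<longleftrightarrow> f \<in> mspace X \<rightarrow> mspace X \<and>
     (\<forall>x\<in>mspace X. \<forall>y\<in>mspace X. x \<noteq> y \<longrightarrow> mdist X (f x) (f y) < mdist X x y)"

definition IFS :: "'a metric \<Rightarrow> ('a \<Rightarrow> 'a) set \<Rightarrow> bool" where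
  "IFS X F \<longleftrightarrow> finite F \<and> (\<forall>f\<in>F. contraction X f)"

definition weak_IFS :: "'a metric \<Rightarrow> ('a \<Rightarrow> 'a) set \<Rightarrow> bool" where
  "weak_IFS X F \<longleftrightarrow> finite F \<and> (\<forall>f\<in>F. weak_contraction X f)"

definition attractor :: "'a metric \<Rightarrow> ('a \<Rightarrow> 'a) set \<Rightarrow> 'a set \<Rightarrow> bool" where
  "attractor X F A \<longleftrightarrow> A \<noteq> {} \<and> compactin (mtopology_of X) A \<and> A = (\<Union>f\<in>F. f ` A)"

text \<open>An IFS has at most one attractor (lemma \<open>attractor_unique\<close>), so no uniqueness clause is
  needed in the definition.\<close>

lemma IFS_common_factor:
  assumes "IFS X F"
  obtains c where "0 \<le> c" "c < 1"
    "\<And>f x y. \<lbrakk>f \<in> F; x \<in> mspace X; y \<in> mspace X\<rbrakk> \<Longrightarrow> mdist X (f x) (f y) \<le> c * mdist X x y"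
proof -
  have "finite F" and "\<forall>f\<in>F. contraction X f"
    using assms by (auto simp: IFS_def)
  then have "\<exists>c. 0 \<le> c \<and> c < 1 \<and> (\<forall>f\<in>F. \<forall>x\<in>mspace X. \<forall>y\<in>mspace X.
               mdist X (f x) (f y) \<le> c * mdist X x y)"
  proof (induction F rule: finite_induct)
    case empty
    show ?case by (intro exI[of _ 0]) auto
  next
    case (insert g F)
    obtain c where c: "0 \<le> c" "c < 1"
      "\<forall>f\<in>F. \<forall>x\<in>mspace X. \<forall>y\<in>mspace X. mdist X (f x) (f y) \<le> c * mdist X x y"
      using insert by auto
    obtain c' where c': "0 \<le> c'" "c' < 1"
      "\<forall>x\<in>mspace X. \<forall>y\<in>mspace X. mdist X (g x) (g y) \<le> c' * mdist X x y"
      using insert.prems by (auto simp: contraction_def)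
    have "mdist X (f x) (f y) \<le> max c c' * mdist X x y"
      if "f \<in> insert g F" "x \<in> mspace X" "y \<in> mspace X" for f x y
    proof -
      have "c * mdist X x y \<le> max c c' * mdist X x y" "c' * mdist X x y \<le> max c c' * mdist X x y"
        by (auto intro: mult_right_mono)
      then show ?thesis using that c(3) c'(3) by fastforce
    qed
    then show ?case using c c' by (intro exI[of _ "max c c'"]) auto
  qed
  then show ?thesis using that by blast
qed

lemma attractor_subset:
  assumes F: "IFS X F" and A: "attractor X F A" and B: "attractor X F B"
  shows "A \<subseteq> B"
proof
  fix a assume "a \<in> A"
  interpret M: Metric_space "mspace X" "mdist X" by simp
  have top: "mtopology_of X = M.mtopology" by (simp add: mtopology_of_def)
  have cA: "compactin M.mtopology A" and cB: "compactin M.mtopology B"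
    using A B by (auto simp: attractor_def top)
  have sA: "A \<subseteq> mspace X" and sB: "B \<subseteq> mspace X"
    using compactin_subset_topspace[OF cA] compactin_subset_topspace[OF cB] by auto
  have eA: "A = (\<Union>f\<in>F. f ` A)" and eB: "B = (\<Union>f\<in>F. f ` B)"
    using A B by (auto simp only: attractor_def)
  obtain c where c: "0 \<le> c" "c < 1"
    and lip: "\<And>f x y. \<lbrakk>f \<in> F; x \<in> mspace X; y \<in> mspace X\<rbrakk>
                \<Longrightarrow> mdist X (f x) (f y) \<le> c * mdist X x y"
    using IFS_common_factor[OF F] by blast
  obtain b0 where b0: "b0 \<in> B" using B by (auto simp: attractor_def)
  have "M.mbounded (A \<union> B)"
    using cA cB by (simp add: M.mbounded_Un M.compactin_imp_mbounded)
  then obtain D where D: "\<And>x y. x \<in> A \<union> B \<Longrightarrow> y \<in> A \<union> B \<Longrightarrow> mdist X x y \<le> D"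
    unfolding M.mbounded_alt by blast
  have close: "\<forall>a\<in>A. \<exists>b\<in>B. mdist X a b \<le> c ^ n * D" for n
  proof (induction n)
    case 0
    show ?case using D b0 by auto
  next
    case (Suc n)
    show ?case
    proof
      fix a assume "a \<in> A"
      then obtain f a' where f: "f \<in> F" "a' \<in> A" "a = f a'" using eA by blast
      obtain b' where b': "b' \<in> B" "mdist X a' b' \<le> c ^ n * D" using Suc f by blast
      have "mdist X a (f b') \<le> c * mdist X a' b'" using lip[of f a' b'] f b' sA sB by blast
      also have "\<dots> \<le> c * (c ^ n * D)" using b' c by (intro mult_left_mono) auto
      finally have "mdist X a (f b') \<le> c ^ Suc n * D" by (simp add: mult.assoc)
      moreover have "f b' \<in> B" using eB f b' by blast
      ultimately show "\<exists>b\<in>B. mdist X a b \<le> c ^ Suc n * D" by blast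
    qed
  qed
  have "\<exists>y\<in>B. y \<in> M.mball a r" if "0 < r" for r
  proof -
    have "(\<lambda>n. c ^ n * D) \<longlonglongrightarrow> 0 * D"
      using c by (intro tendsto_mult LIMSEQ_realpow_zero tendsto_const) auto
    then have "\<forall>\<^sub>F n in sequentially. c ^ n * D < r"
      using \<open>0 < r\<close> by (auto intro: order_tendstoD)
    then obtain n where n: "c ^ n * D < r" by (auto simp: eventually_sequentially)
    obtain b where b: "b \<in> B" "mdist X a b \<le> c ^ n * D" using close \<open>a \<in> A\<close> by blast
    then have "b \<in> M.mball a r"
      using n sA sB \<open>a \<in> A\<close> by auto
    then show ?thesis using b by blast
  qed
  then have "a \<in> M.mtopology closure_of B"
    using \<open>a \<in> A\<close> sA by (auto simp only: M.metric_closure_of)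
  moreover have "closedin M.mtopology B"
    using compactin_imp_closedin[OF M.Hausdorff_space_mtopology cB] .
  ultimately show "a \<in> B" by (metis closure_of_eq)
qed

lemma attractor_unique:
  assumes "IFS X F" "attractor X F A" "attractor X F B"
  shows "A = B"
  using attractor_subset assms by blast

definition isometric_embedding :: "'a metric \<Rightarrow> 'b metric \<Rightarrow> ('a \<Rightarrow> 'b) \<Rightarrow> bool" where
  "isometric_embedding A X e \<longleftrightarrow> e \<in> mspace A \<rightarrow> mspace X \<and>
     (\<forall>x\<in>mspace A. \<forall>y\<in>mspace A. mdist X (e x) (e y) = mdist A x y)"

text \<open>HOL cannot quantify over metric spaces of all types, so the notions ``some metric space''
  below carry a type argument: the points of the ambient space \<open>X\<close> are taken from that type, with
  any carrier and any metric on it. A space \<open>A\<close> lies in \<open>X\<close> as a metric subspace via an isometric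
  copy. A positive assertion for one type gives the existence of \<open>X\<close>; a negative
  assertion has to be made for an arbitrary type.\<close>

definition IFS_attractor :: "'b itself \<Rightarrow> 'a metric \<Rightarrow> bool" where
  "IFS_attractor TYPE('b) A \<longleftrightarrow> compact_space (mtopology_of A) \<and>
     (\<exists>(X :: 'b metric) F e. isometric_embedding A X e \<and> IFS X F \<and> attractor X F (e ` mspace A))"

definition weak_IFS_attractor :: "'b itself \<Rightarrow> 'a metric \<Rightarrow> bool" where
  "weak_IFS_attractor TYPE('b) A \<longleftrightarrow> compact_space (mtopology_of A) \<and>
     (\<exists>(X :: 'b metric) F e. isometric_embedding A X e \<and> weak_IFS X F \<and> attractor X F (e ` mspace A))"

definition Banach_fractal :: "'b itself \<Rightarrow> 'a topology \<Rightarrow> bool" where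
  "Banach_fractal TYPE('b) T \<longleftrightarrow> compact_space T \<and> metrizable_space T \<and>
     (\<exists>(X :: 'b metric) F K. mcomplete_of X \<and> IFS X F \<and> attractor X F K \<and>
        T homeomorphic_space subtopology (mtopology_of X) K)"

definition polar :: "real \<Rightarrow> real \<Rightarrow> real ^ 2" where
  "polar r \<alpha> = vector [r * cos \<alpha>, r * sin \<alpha>]"

definition snake_O :: "nat \<Rightarrow> (real ^ 2) set" where
  "snake_O n = {polar (1 / real n) \<alpha> | \<alpha>. \<alpha> \<in> {pi / 2 <.. 2 * pi}}"

definition snake_angle :: "nat \<Rightarrow> real" where
  "snake_angle n = (if odd n then pi / 2 else 0)"

definition snake_I :: "nat \<Rightarrow> (real ^ 2) set" where
  "snake_I n = {polar r (snake_angle n) | r. r \<in> {1 / (real n + 1) .. 1 / real n}}"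

definition snake :: "(real ^ 2) set" where
  "snake = {0} \<union> (\<Union>n\<in>{1..}. snake_O n \<union> snake_I n)"

definition snake_metric :: "(real ^ 2) metric" where
  "snake_metric = submetric euclidean_metric snake"

end

theory Submission
  imports Defs
begin

text \<open>The map \<open>x \<mapsto> x / (1 + 2 \<bar>x\<bar>)\<close> is a weak contraction of the plane which moves the snake
  two arcs inwards. What it misses has finite length and is therefore covered by finitely many
  short Lipschitz paths composed with the norm, which maps the snake onto \<open>[0, 1]\<close>.

  If the snake were covered by its images under finitely many contractions, one of the images, of
  \<open>f\<close> say, would be a nondegenerate connected set containing \<open>0\<close> and hence a whole tail of the
  snake. For large \<open>n\<close>, whether or not \<open>f 0 = 0\<close>, the points of norm at least \<open>1 / n\<close> in that tail come from points
  of norm at least \<open>1 / n\<close>. Their lengths grow like the harmonic numbers with the same factor, so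
  \<open>f\<close> cannot shrink lengths by a factor smaller than \<open>1\<close>.\<close>

section \<open>Polar coordinates\<close>

text \<open>Near the origin the factors of \<open>shrink\<close> tend to \<open>1\<close>; this is
  the room that a contraction lacks. The obstacle is the infinite length of the snake: lengths can
  be compared only after truncation at norm \<open>1 / n\<close>. The truncations match because a
  contraction with \<open>f 0 = 0\<close> does not increase norms on the snake, while for
  \<open>f 0 \<noteq> 0\<close> preimages of points near \<open>0\<close> stay away from
  \<open>0\<close>. Both truncated lengths are \<open>3 * pi / 2 * harm n\<close> up to bounded
  terms: the segments add less than \<open>1\<close> in total, and the arcs outside the tail cost a
  constant. Divergence of the harmonic series absorbs these terms. The scale of the counting is
  fixed only after \<open>n\<close>, so that the rounding errors stay bounded too.\<close>

lemma inner_polar: "polar r a \<bullet> polar s b = r * s * cos (a - b)"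
  by (simp add: polar_def inner_vec_def sum_2 cos_diff algebra_simps)

lemma norm_polar [simp]: "norm (polar r a) = \<bar>r\<bar>"
  by (simp add: norm_eq_sqrt_inner inner_polar flip: power2_eq_square)

lemma scaleR_polar: "c *\<^sub>R polar r a = polar (c * r) a"
  by (simp add: polar_def vec_eq_iff forall_2)

lemma polar_2pi [simp]: "polar r (2 * pi) = polar r 0"
  by (simp add: polar_def)

lemma polar_0 [simp]: "polar 0 a = 0"
  by (simp add: polar_def vec_eq_iff forall_2)

text \<open>The law of cosines in half-angle form, which separates the radial from the angular
  contribution.\<close>

lemma dist_polar_square:
  "(dist (polar r a) (polar s b))\<^sup>2 = (r - s)\<^sup>2 + 4 * r * s * (sin ((a - b) / 2))\<^sup>2"
proof -
  have "cos (a - b) = 1 - 2 * (sin ((a - b) / 2))\<^sup>2"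
    using cos_double_sin[of "(a - b) / 2"] by (simp only: field_sum_of_halves mult_2)
  moreover have "cos (b - a) = cos (a - b)"
    by (simp add: cos_diff)
  ultimately show ?thesis
    unfolding dist_norm power2_norm_eq_inner
    by (simp only: inner_diff_left inner_diff_right inner_polar) (simp add: power2_eq_square algebra_simps)
qed

lemma dist_polar_same_radius:
  assumes "0 \<le> r"
  shows "dist (polar r a) (polar r b) = 2 * r * \<bar>sin ((a - b) / 2)\<bar>"
proof -
  have "(dist (polar r a) (polar r b))\<^sup>2 = (2 * r * \<bar>sin ((a - b) / 2)\<bar>)\<^sup>2"
    by (simp add: dist_polar_square power_mult_distrib) (simp add: power2_eq_square)
  then show ?thesis
    using assms by (subst (asm) power2_eq_iff_nonneg) auto
qed

lemma dist_polar_same_radius_le: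
  assumes "0 \<le> r"
  shows "dist (polar r a) (polar r b) \<le> r * \<bar>a - b\<bar>"
proof -
  have "2 * r * \<bar>sin ((a - b) / 2)\<bar> \<le> 2 * r * \<bar>(a - b) / 2\<bar>"
    using assms by (intro mult_left_mono abs_sin_x_le_abs_x) auto
  then show ?thesis
    using assms by (simp add: dist_polar_same_radius)
qed

lemma dist_polar_same_angle: "dist (polar r a) (polar s a) = \<bar>r - s\<bar>"
proof -
  have "(dist (polar r a) (polar s a))\<^sup>2 = \<bar>r - s\<bar>\<^sup>2"
    by (simp add: dist_polar_square)
  then show ?thesis
    by (subst (asm) power2_eq_iff_nonneg) auto
qed

lemma polar_eqD:
  assumes eq: "polar r a = polar s b" and pos: "0 < r" "0 < s"
    and angle: "\<bar>a - b\<bar> < 2 * pi"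
  shows "r = s" "a = b"
proof -
  show "r = s"
    using arg_cong[OF eq, of norm] pos by simp
  then have "sin ((a - b) / 2) = 0"
    using dist_polar_same_radius[of r a b] eq pos by auto
  moreover have "\<bar>(a - b) / 2\<bar> < pi"
    using angle by simp
  ultimately show "a = b"
    using sin_eq_0_pi[of "(a - b) / 2"] by auto
qed

lemma continuous_on_polar [continuous_intros]:
  fixes A :: "'c :: t2_space set"
  assumes "continuous_on A r" "continuous_on A a"
  shows "continuous_on A (\<lambda>x. polar (r x) (a x))"
proof -
  have "polar (r x) (a x) = (\<chi> i. if i = 1 then r x * cos (a x) else r x * sin (a x))" for x
    by (simp add: polar_def vec_eq_iff forall_2)
  moreover have "continuous_on A (\<lambda>x. if i = 1 then r x * cos (a x) else r x * sin (a x))" for i :: 2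
    using assms by (cases "i = 1") (auto intro!: continuous_on_mult continuous_on_cos continuous_on_sin)
  ultimately show ?thesis
    by (simp add: continuous_on_vec_lambda)
qed

section \<open>Points of the snake\<close>

lemma snake_I_subset: "n \<ge> 1 \<Longrightarrow> snake_I n \<subseteq> snake"
  by (auto simp: snake_def)

lemma snake_O_subset: "n \<ge> 1 \<Longrightarrow> snake_O n \<subseteq> snake"
  by (auto simp: snake_def)

lemma zero_in_snake [simp]: "0 \<in> snake"
  by (auto simp: snake_def)

lemma polar_in_snake_I:
  assumes "n \<ge> 1" "1 / (real n + 1) \<le> r" "r \<le> 1 / real n"
  shows "polar r (snake_angle n) \<in> snake"
  using assms snake_I_subset[of n] by (auto simp: snake_I_def)

text \<open>The endpoint \<open>pi / 2\<close>, which \<open>snake_O n\<close> omits, is supplied by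
  a segment: the outer end of segment \<open>n\<close> if \<open>n\<close> is odd, the inner end of
  segment \<open>n - 1\<close> if \<open>n\<close> is even.\<close>

lemma polar_in_snake_O:
  assumes "n \<ge> 1" "pi / 2 \<le> a" "a \<le> 2 * pi"
  shows "polar (1 / real n) a \<in> snake"
proof (cases "a = pi / 2")
  case False
  then have "polar (1 / real n) a \<in> snake_O n"
    using assms by (auto simp: snake_O_def)
  then show ?thesis
    using assms snake_O_subset[of n] by auto
next
  case a: True
  show ?thesis
    unfolding a
  proof (cases "odd n")
    case True
    then show "polar (1 / real n) (pi / 2) \<in> snake"
      using polar_in_snake_I[of n "1 / real n"] assms
      by (simp add: snake_angle_def divide_left_mono)
  next
    case False
    then obtain m where m: "n = Suc m" "odd m"
      using assms by (cases n) auto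
    then have "m \<ge> 1"
      by presburger
    then show "polar (1 / real n) (pi / 2) \<in> snake"
      using polar_in_snake_I[of m "1 / real n"] m
      by (simp add: snake_angle_def divide_left_mono add.commute)
  qed
qed

lemma snake_cases:
  assumes "x \<in> snake"
  obtains (zero) "x = 0"
    | (arc) n a where "n \<ge> 1" "pi / 2 \<le> a" "a \<le> 2 * pi" "x = polar (1 / real n) a"
    | (radial) n r where "n \<ge> 1" "1 / (real n + 1) \<le> r" "r \<le> 1 / real n"
        "x = polar r (snake_angle n)"
proof -
  consider "x = 0" | n where "n \<ge> 1" "x \<in> snake_O n" | n where "n \<ge> 1" "x \<in> snake_I n"
    using assms by (auto simp: snake_def)
  then show ?thesis
  proof cases
    case (2 n)
    then obtain a where "x = polar (1 / real n) a" "pi / 2 < a" "a \<le> 2 * pi"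
      by (auto simp: snake_O_def)
    then show ?thesis using arc[of n a] 2 by simp
  next
    case (3 n)
    then obtain r where "x = polar r (snake_angle n)" "1 / (real n + 1) \<le> r" "r \<le> 1 / real n"
      by (auto simp: snake_I_def)
    then show ?thesis using radial[of n r] 3 by simp
  qed (rule zero)
qed

lemma norm_snake_le:
  assumes "x \<in> snake"
  shows "norm x \<le> 1"
  using assms
proof (cases rule: snake_cases)
  case zero
  show ?thesis unfolding zero by simp
next
  case (arc n a)
  have "1 / real n \<le> 1"
    using arc(1) by simp
  then show ?thesis
    unfolding arc(4) norm_polar by simp
next
  case (radial n r)
  have "0 \<le> 1 / (real n + 1)"
    by simp
  moreover have "1 / real n \<le> 1"
    using radial(1) by simp
  ultimately have "\<bar>r\<bar> \<le> 1"
    using radial(2,3) by linarith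
  then show ?thesis
    unfolding radial(4) norm_polar .
qed

lemma ex_snake_norm:
  assumes "0 \<le> r" "r \<le> 1"
  obtains x where "x \<in> snake" "norm x = r"
proof (cases "r = 0")
  case True
  then show ?thesis using that[of 0] by simp
next
  case False
  define n where "n = nat \<lfloor>1 / r\<rfloor>"
  have "1 \<le> 1 / r"
    using assms False by simp
  then have "1 \<le> \<lfloor>1 / r\<rfloor>"
    by linarith
  then have n: "n \<ge> 1" "real n \<le> 1 / r" "1 / r < real n + 1"
    unfolding n_def by linarith+
  then have "1 / (real n + 1) \<le> r" "r \<le> 1 / real n"
    using assms False by (auto simp: field_simps)
  then show ?thesis
    using that[of "polar r (snake_angle n)"] polar_in_snake_I[of n r] n assms by simp
qed

section \<open>The snake is an arc\<close>

text \<open>A triangle wave in closed form, so that the parametrization of the snake is continuous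
  without gluing at the joints of arcs and segments.\<close>

definition zigzag :: "real \<Rightarrow> real" where
  "zigzag x = arccos (cos x)"

lemma zigzag_periodic: "zigzag (x + 2 * pi * real k) = zigzag x"
proof -
  have "cos (x + 2 * pi * real k) = cos x"
  proof (induction k)
    case (Suc k)
    then show ?case
      using cos_periodic[of "x + 2 * pi * real k"] by (simp add: algebra_simps)
  qed simp
  then show ?thesis
    by (simp add: zigzag_def)
qed

lemma zigzag_eq_abs: "\<bar>x\<bar> \<le> pi \<Longrightarrow> zigzag x = \<bar>x\<bar>"
  unfolding zigzag_def using arccos_cos[of "\<bar>x\<bar>"] by simp

lemma zigzag_reflect: "pi \<le> x \<Longrightarrow> x \<le> 2 * pi \<Longrightarrow> zigzag x = 2 * pi - x"
  unfolding zigzag_def using arccos_cos[of "2 * pi - x"] by simp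

lemma continuous_on_zigzag [continuous_intros]:
  fixes A :: "'c :: t2_space set"
  shows "continuous_on A f \<Longrightarrow> continuous_on A (\<lambda>x. zigzag (f x))"
  unfolding zigzag_def by (intro continuous_intros) auto

text \<open>\<open>zigzag x\<close> is the distance from \<open>x\<close> to the nearest multiple of \<open>2 \<pi>\<close>.
  The snake is traversed from the outside inwards: for \<open>0 \<le> v \<le> 1\<close> the parameter \<open>2 k + v\<close>
  runs through the \<open>(k+1)\<close>-th circular arc and \<open>2 k + 1 + v\<close> through the \<open>(k+1)\<close>-th segment.\<close>

definition snake_inv_radius :: "real \<Rightarrow> real" where
  "snake_inv_radius u = 1 + u / 2 - zigzag (pi * u) / (2 * pi)"

text \<open>The difference of the two shifted triangle waves is a trapezoidal wave of period
  \<open>4\<close> between \<open>- pi / 2\<close> and \<open>pi / 2\<close>. The constants stretch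
  it to run between \<open>pi / 2\<close> and \<open>2 * pi\<close>, with plateaus on the segments.
  A period takes two arcs because consecutive arcs are traversed in opposite senses.\<close>

definition snake_arg :: "real \<Rightarrow> real" where
  "snake_arg u = 5 * pi / 4 + 3 / 2 * (zigzag (pi * (u - 1) / 2) - zigzag (pi * u / 2))"

definition snake_point :: "real \<Rightarrow> real ^ 2" where
  "snake_point u = polar (1 / snake_inv_radius u) (snake_arg u)"

text \<open>On an arc the subtracted wave has slope \<open>1 / 2\<close> and cancels
  \<open>u / 2\<close>; on a segment its slope is \<open>- 1 / 2\<close>, so that the inverse radius
  grows at unit speed.\<close>

lemma snake_inv_radius_arc:
  assumes "0 \<le> v" "v \<le> 1"
  shows "snake_inv_radius (2 * real k + v) = real k + 1"
proof -
  have "zigzag (pi * (2 * real k + v)) = pi * v"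
    using zigzag_periodic[of "pi * v" k] zigzag_eq_abs[of "pi * v"] assms
    by (simp add: algebra_simps)
  then show ?thesis
    by (simp add: snake_inv_radius_def field_simps)
qed

lemma snake_inv_radius_segment:
  assumes "0 \<le> v" "v \<le> 1"
  shows "snake_inv_radius (2 * real k + 1 + v) = real k + 1 + v"
proof -
  have "zigzag (pi * (2 * real k + 1 + v)) = 2 * pi - pi * (1 + v)"
    using zigzag_periodic[of "pi * (1 + v)" k] zigzag_reflect[of "pi * (1 + v)"] assms
    by (simp add: algebra_simps)
  then show ?thesis
    by (simp add: snake_inv_radius_def field_simps)
qed

lemma snake_arg_periodic: "snake_arg (4 * real k + u) = snake_arg u"
  using zigzag_periodic[of "pi * (u - 1) / 2" k] zigzag_periodic[of "pi * u / 2" k]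
  by (simp add: snake_arg_def algebra_simps add_divide_distrib diff_divide_distrib)

lemma zigzag_half_abs: "-2 \<le> v \<Longrightarrow> v \<le> 2 \<Longrightarrow> zigzag (pi * v / 2) = pi * \<bar>v\<bar> / 2"
  by (subst zigzag_eq_abs) (auto simp: abs_mult abs_le_iff intro: mult_left_mono)

lemma zigzag_half_reflect: "2 \<le> v \<Longrightarrow> v \<le> 4 \<Longrightarrow> zigzag (pi * v / 2) = 2 * pi - pi * v / 2"
  by (subst zigzag_reflect) (auto intro: mult_left_mono)

lemma snake_arg_base:
  assumes "0 \<le> v" "v \<le> 1"
  shows "snake_arg v = 2 * pi - 3 * pi / 2 * v" "snake_arg (1 + v) = pi / 2"
    "snake_arg (2 + v) = pi / 2 + 3 * pi / 2 * v" "snake_arg (3 + v) = 2 * pi"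
  using assms
    zigzag_half_abs[of "v - 1"] zigzag_half_abs[of v] zigzag_half_abs[of "1 + v"]
    zigzag_half_reflect[of "2 + v"] zigzag_half_reflect[of "3 + v"]
  by (simp_all add: snake_arg_def field_simps zigzag_half_reflect)

lemma snake_arg_arc:
  assumes "0 \<le> v" "v \<le> 1"
  shows "snake_arg (2 * real k + v) =
    (if even k then 2 * pi - 3 * pi / 2 * v else pi / 2 + 3 * pi / 2 * v)"
proof (cases "even k")
  case True
  then obtain j where "k = 2 * j" by blast
  then show ?thesis
    using snake_arg_periodic[of j v] snake_arg_base[OF assms] by simp
next
  case False
  then obtain j where "k = 2 * j + 1" by (elim oddE)
  then show ?thesis
    using snake_arg_periodic[of j "2 + v"] snake_arg_base[OF assms] by (simp add: algebra_simps)
qed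

lemma snake_arg_segment:
  assumes "0 \<le> v" "v \<le> 1"
  shows "snake_arg (2 * real k + 1 + v) = (if even k then pi / 2 else 2 * pi)"
proof (cases "even k")
  case True
  then obtain j where "k = 2 * j" by blast
  then show ?thesis
    using snake_arg_periodic[of j "1 + v"] snake_arg_base[OF assms] by (simp add: algebra_simps)
next
  case False
  then obtain j where "k = 2 * j + 1" by (elim oddE)
  then show ?thesis
    using snake_arg_periodic[of j "3 + v"] snake_arg_base[OF assms] by (simp add: algebra_simps)
qed

lemma snake_point_segment:
  assumes "0 \<le> v" "v \<le> 1"
  shows "snake_point (2 * real k + 1 + v) = polar (1 / (real k + 1 + v)) (snake_angle (Suc k))"
  using assms by (simp add: snake_point_def snake_inv_radius_segment snake_arg_segment snake_angle_def)

lemma snake_point_arc: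
  assumes "0 \<le> v" "v \<le> 1"
  shows "snake_point (2 * real k + v) = polar (1 / real (Suc k))
    (if even k then 2 * pi - 3 * pi / 2 * v else pi / 2 + 3 * pi / 2 * v)"
  unfolding snake_point_def snake_inv_radius_arc[OF assms] snake_arg_arc[OF assms]
  by (simp add: add.commute)

text \<open>Arcs are taken with both ends and segments with none, so the two cases exclude each
  other; injectivity relies on this.\<close>

lemma snake_parameter_cases:
  fixes u :: real
  assumes "0 \<le> u"
  obtains (arc) k v where "0 \<le> v" "v \<le> 1" "u = 2 * real k + v"
    | (segment) k v where "0 < v" "v < 1" "u = 2 * real k + 1 + v"
proof -
  define k where "k = nat \<lfloor>u / 2\<rfloor>"
  have k: "real k \<le> u / 2" "u / 2 < real k + 1"
    using assms unfolding k_def by linarith+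
  show ?thesis
  proof (cases "u - 2 * real k \<le> 1")
    case True
    then show ?thesis using arc[of "u - 2 * real k" k] k by simp
  next
    case False
    then show ?thesis using segment[of "u - 2 * real k - 1" k] k by simp
  qed
qed

text \<open>Keeps the inverse radius positive and forces the radius to \<open>0\<close> as
  \<open>u\<close> grows, which makes \<open>snake_path\<close> continuous at
  \<open>0\<close>.\<close>

lemma snake_inv_radius_ge:
  assumes "0 \<le> u"
  shows "(1 + u) / 2 \<le> snake_inv_radius u"
  using assms
proof (cases rule: snake_parameter_cases)
  case (arc k v)
  then show ?thesis by (simp add: snake_inv_radius_arc)
next
  case (segment k v)
  then show ?thesis by (simp add: snake_inv_radius_segment)
qed

lemma snake_arg_bounds:
  assumes "0 \<le> u"
  shows "pi / 2 \<le> snake_arg u" "snake_arg u \<le> 2 * pi"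
proof -
  have "pi / 2 \<le> snake_arg u \<and> snake_arg u \<le> 2 * pi"
    using assms
  proof (cases rule: snake_parameter_cases)
    case (arc k v)
    then have "0 \<le> pi * v" "pi * v \<le> pi"
      by auto
    then show ?thesis
      unfolding arc(3) snake_arg_arc[OF arc(1,2)] by (intro conjI; cases "even k"; simp only: if_True if_False; linarith)
  next
    case (segment k v)
    then show ?thesis by (simp add: snake_arg_segment)
  qed
  then show "pi / 2 \<le> snake_arg u" "snake_arg u \<le> 2 * pi" by auto
qed

lemma snake_point_in_snake:
  assumes "0 \<le> u"
  shows "snake_point u \<in> snake"
  using assms
proof (cases rule: snake_parameter_cases)
  case (arc k v)
  have "snake_point u = polar (1 / real (Suc k)) (snake_arg u)"
    unfolding snake_point_def arc(3) snake_inv_radius_arc[OF arc(1,2)] by (simp add: add.commute)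
  then show ?thesis
    using polar_in_snake_O[of "Suc k"] snake_arg_bounds[OF assms] by simp
next
  case (segment k v)
  then have "polar (1 / (real k + 1 + v)) (snake_angle (Suc k)) \<in> snake"
    by (intro polar_in_snake_I) (auto simp: field_simps)
  then show ?thesis
    using segment by (simp add: snake_point_segment)
qed

lemma snake_point_surj:
  assumes "x \<in> snake" "x \<noteq> 0"
  obtains u where "0 \<le> u" "x = snake_point u"
  using assms(1)
proof (cases rule: snake_cases)
  case zero
  then show ?thesis using assms by simp
next
  case (arc n a)
  then obtain k where k: "n = Suc k" by (cases n) auto
  define v where "v = (if even k then (2 * pi - a) / (3 * pi / 2) else (a - pi / 2) / (3 * pi / 2))"
  have v: "0 \<le> v" "v \<le> 1"
    using arc by (auto simp: v_def field_simps)
  have "(if even k then 2 * pi - 3 * pi / 2 * v else pi / 2 + 3 * pi / 2 * v) = a"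
    by (simp add: v_def field_simps)
  then show ?thesis
    using that[of "2 * real k + v"] snake_point_arc[OF v, of k] v arc k by simp
next
  case (radial n r)
  then obtain k where k: "n = Suc k" by (cases n) auto
  define v where "v = 1 / r - real n"
  have "0 < 1 / (real n + 1)" by simp
  then have "0 < r" using radial by linarith
  then have v: "0 \<le> v" "v \<le> 1" "1 / (real k + 1 + v) = r"
    using radial k by (auto simp: v_def field_simps)
  then show ?thesis
    using that[of "2 * real k + 1 + v"] snake_point_segment[OF v(1,2), of k] radial k by simp
qed

lemma snake_point_nonzero: "0 \<le> u \<Longrightarrow> snake_point u \<noteq> 0"
proof
  assume "0 \<le> u" "snake_point u = 0"
  then show False
    using snake_inv_radius_ge[of u] arg_cong[of _ _ norm, OF \<open>snake_point u = 0\<close>]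
    unfolding snake_point_def norm_polar by simp
qed

text \<open>The inverse radius is an integer on arcs and never one inside a segment, so it tells the
  two kinds apart. It also determines the index of an arc and the position on a segment; the
  position on an arc comes from the angle.\<close>

lemma inj_snake_point:
  assumes "0 \<le> u" "0 \<le> w" "snake_point u = snake_point w"
  shows "u = w"
proof -
  note pos = snake_inv_radius_ge[OF assms(1)] snake_inv_radius_ge[OF assms(2)]
  \<comment> \<open>The angles span only \<open>3 * pi / 2\<close>, so a nonzero point determines
    its polar coordinates.\<close>
  have "\<bar>snake_arg u - snake_arg w\<bar> < 2 * pi"
    using snake_arg_bounds[OF assms(1)] snake_arg_bounds[OF assms(2)] pi_gt_zero by linarith
  then have arg: "snake_arg u = snake_arg w"
    and "1 / snake_inv_radius u = 1 / snake_inv_radius w"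
    using polar_eqD[of "1 / snake_inv_radius u" "snake_arg u" "1 / snake_inv_radius w" "snake_arg w"]
      assms pos unfolding snake_point_def by auto
  then have rad: "snake_inv_radius u = snake_inv_radius w"
    by simp
  have frac: "real k + 1 \<noteq> real j + 1 + v" if "0 < v" "v < 1" for k j :: nat and v
  proof
    assume "real k + 1 = real j + 1 + v"
    then have "j < k" "k < Suc j" using that by linarith+
    then show False by simp
  qed
  show ?thesis
    using assms(1)
  proof (cases rule: snake_parameter_cases)
    case u: (arc k v)
    show ?thesis
      using assms(2)
    proof (cases rule: snake_parameter_cases)
      case w: (arc j v')
      have "k = j"
        using rad u w by (simp add: snake_inv_radius_arc)
      then have "v = v'"
        using arg u w by (auto simp: snake_arg_arc split: if_splits)
      then show ?thesis using u w \<open>k = j\<close> by simp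
    next
      case w: (segment j v')
      then show ?thesis
        using rad u frac[of v' k j] by (simp add: snake_inv_radius_arc snake_inv_radius_segment)
    qed
  next
    case u: (segment k v)
    show ?thesis
      using assms(2)
    proof (cases rule: snake_parameter_cases)
      case w: (arc j v')
      then show ?thesis
        using rad u frac[of v j k] by (simp add: snake_inv_radius_arc snake_inv_radius_segment)
    next
      case w: (segment j v')
      then have eq: "real k + v = real j + v'"
        using rad u by (simp add: snake_inv_radius_segment)
      then have "k = j"
        using u w by linarith
      then show ?thesis using u w eq by (simp add: \<open>k = j\<close>)
    qed
  qed
qed

text \<open>The substitution \<open>u = 1 / t - 1\<close> compactifies the parameter:
  \<open>t = 1\<close> is the outer end of the snake, and the limit point
  \<open>u = \<infinity>\<close> becomes \<open>t = 0\<close>.\<close>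

definition snake_path :: "real \<Rightarrow> real ^ 2" where
  "snake_path t = (if t = 0 then 0 else snake_point (1 / t - 1))"

lemma norm_snake_path_le:
  assumes "0 \<le> t" "t \<le> 1"
  shows "norm (snake_path t) \<le> 2 * t"
proof (cases "t = 0")
  case False
  then have "0 \<le> 1 / t - 1"
    using assms by simp
  then have ge: "1 / t / 2 \<le> snake_inv_radius (1 / t - 1)"
    using snake_inv_radius_ge[of "1 / t - 1"] by simp
  have pos: "0 < 1 / t / 2"
    using assms False by simp
  have "0 < snake_inv_radius (1 / t - 1)"
    using ge pos by linarith
  moreover have "1 / snake_inv_radius (1 / t - 1) \<le> 2 * t"
    using le_imp_inverse_le[OF ge pos] by (simp add: inverse_eq_divide mult.commute)
  ultimately show ?thesis
    using False by (simp add: snake_path_def snake_point_def)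
qed (simp add: snake_path_def)

lemma continuous_on_snake_point: "continuous_on {0..} snake_point"
proof -
  have "snake_inv_radius u \<noteq> 0" if "u \<in> {0..}" for u
    using snake_inv_radius_ge[of u] that by auto
  moreover have "continuous_on {0..} snake_inv_radius" "continuous_on {0..} snake_arg"
    unfolding snake_inv_radius_def snake_arg_def by (intro continuous_intros; simp)+
  ultimately show ?thesis
    unfolding snake_point_def by (intro continuous_intros) auto
qed

lemma continuous_on_snake_path: "continuous_on {0..1} snake_path"
  unfolding continuous_on_eq_continuous_within
proof
  fix t :: real assume t: "t \<in> {0..1}"
  show "continuous (at t within {0..1}) snake_path"
  proof (cases "t = 0")
    case True
    have "((\<lambda>t::real. 2 * t) \<longlongrightarrow> 2 * 0) (at 0 within {0..1})"
      by (intro tendsto_intros)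
    then have lim: "((\<lambda>t::real. 2 * t) \<longlongrightarrow> 0) (at 0 within {0..1})"
      by simp
    have "(snake_path \<longlongrightarrow> 0) (at 0 within {0..1})"
      by (rule Lim_null_comparison[OF _ lim])
        (auto simp: eventually_at norm_snake_path_le intro!: exI[of _ 1])
    then show ?thesis
      using True by (simp add: continuous_within snake_path_def)
  next
    case False
    have "continuous_on {0<..1} (\<lambda>t. snake_point (1 / t - 1))"
      by (rule continuous_on_compose2[OF continuous_on_snake_point])
        (auto intro!: continuous_intros)
    then have "continuous_on {0<..1} snake_path"
      by (rule continuous_on_eq) (auto simp: snake_path_def)
    then have "continuous (at t within {0<..1}) snake_path"
      using t False by (auto simp: continuous_on_eq_continuous_within)
    moreover have "at t within {0<..1} = at t within {0..1}"
      using t False by (intro at_within_nhd[where S = "{0<..}"]) auto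
    ultimately show ?thesis
      by simp
  qed
qed

lemma inj_on_snake_path: "inj_on snake_path {0..1}"
proof (rule inj_onI)
  fix s t :: real assume st: "s \<in> {0..1}" "t \<in> {0..1}" and eq: "snake_path s = snake_path t"
  then have nonneg: "s \<noteq> 0 \<Longrightarrow> 0 \<le> 1 / s - 1" "t \<noteq> 0 \<Longrightarrow> 0 \<le> 1 / t - 1"
    by (auto simp: field_simps)
  show "s = t"
  proof (cases "s = 0 \<or> t = 0")
    case True
    then show ?thesis
      using eq snake_point_nonzero nonneg by (auto simp: snake_path_def split: if_splits)
  next
    case False
    then have "1 / s - 1 = 1 / t - 1"
      using inj_snake_point nonneg eq by (auto simp: snake_path_def)
    then show ?thesis by simp
  qed
qed

lemma snake_path_image: "snake_path ` {0..1} = snake"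
proof
  show "snake_path ` {0..1} \<subseteq> snake"
    by (auto simp: snake_path_def snake_point_in_snake)
  show "snake \<subseteq> snake_path ` {0..1}"
  proof
    fix x assume x: "x \<in> snake"
    show "x \<in> snake_path ` {0..1}"
    proof (cases "x = 0")
      case True
      then show ?thesis by (force simp: snake_path_def)
    next
      case False
      then obtain u where u: "0 \<le> u" "x = snake_point u"
        using snake_point_surj x by blast
      then have "x = snake_path (1 / (1 + u))" "1 / (1 + u) \<in> {0..1}"
        by (auto simp: snake_path_def)
      then show ?thesis by blast
    qed
  qed
qed

lemma compact_snake: "compact snake"
  using compact_continuous_image[OF continuous_on_snake_path] by (simp add: snake_path_image)

lemma homeomorphism_snake_path:
  obtains h where "homeomorphism {0..1} snake snake_path h"
  using homeomorphism_compact[OF compact_Icc continuous_on_snake_path snake_path_image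
      inj_on_snake_path] by blast

lemma snake_homeomorphic_interval: "snake homeomorphic {0..1::real}"
  using homeomorphism_snake_path homeomorphic_def homeomorphic_sym by blast

section \<open>The snake is a weak IFS-attractor\<close>

lemma mspace_snake_metric [simp]: "mspace snake_metric = snake"
  by (simp add: snake_metric_def)

lemma mdist_snake_metric [simp]: "mdist snake_metric = dist"
  by (simp add: snake_metric_def)

lemma mtopology_of_snake_metric: "mtopology_of snake_metric = top_of_set snake"
  by (simp add: snake_metric_def mtopology_of_submetric)

lemma compact_space_snake: "compact_space (mtopology_of snake_metric)"
  by (simp add: mtopology_of_snake_metric compact_snake compact_space_subtopology)

lemma dist_square_norm_inner:
  fixes x y :: "'c :: real_inner"
  shows "(dist x y)\<^sup>2 = (norm x - norm y)\<^sup>2 + 2 * (norm x * norm y - x \<bullet> y)"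
  by (simp add: dist_norm power2_norm_eq_inner power2_diff inner_diff_left inner_diff_right
      inner_commute)

text \<open>In polar coordinates the map fixes the angle and sends the radius \<open>r\<close> to \<open>r / (1 + 2 r)\<close>,
  hence \<open>1 / n\<close> to \<open>1 / (n + 2)\<close>; the shift by two preserves the angle of the segments.\<close>

definition shrink :: "'c :: real_inner \<Rightarrow> 'c" where
  "shrink x = (1 / (1 + 2 * norm x)) *\<^sub>R x"

text \<open>The difference of the norms is divided by exactly \<open>D\<close>, and so is the
  Cauchy-Schwarz defect. In the squared distance the radial part thus loses the factor
  \<open>D\<^sup>2\<close> and the angular part \<open>D\<close>, where \<open>D > 1\<close> unless
  both points are \<open>0\<close>.\<close>

lemma dist_shrink_less:
  fixes x y :: "'c :: real_inner"
  assumes "x \<noteq> y"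
  shows "dist (shrink x) (shrink y) < dist x y"
proof -
  define A B D where "A = 1 + 2 * norm x" and "B = 1 + 2 * norm y" and "D = A * B"
  have AB: "1 \<le> A" "1 \<le> B"
    by (auto simp: A_def B_def)
  have "A > 1 \<or> B > 1"
    using assms by (auto simp: A_def B_def)
  then have D: "D > 1"
    unfolding D_def using AB by (metis less_1_mult mult.right_neutral mult_1 order_le_less)
  have norms: "norm (shrink x) = norm x / A" "norm (shrink y) = norm y / B"
    using AB by (auto simp: shrink_def A_def B_def)
  have inner: "shrink x \<bullet> shrink y = (x \<bullet> y) / D"
    by (simp add: shrink_def A_def B_def D_def)
  have diff: "norm x / A - norm y / B = (norm x - norm y) / D"
    using AB unfolding D_def by (simp add: diff_frac_eq) (simp add: A_def B_def algebra_simps)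
  have CS: "0 \<le> norm x * norm y - x \<bullet> y"
    using norm_cauchy_schwarz[of x y] by simp
  have "(dist (shrink x) (shrink y))\<^sup>2 =
      (norm x - norm y)\<^sup>2 / D\<^sup>2 + 2 * (norm x * norm y - x \<bullet> y) / D"
    unfolding dist_square_norm_inner norms inner diff power_divide
    by (simp add: diff_divide_distrib right_diff_distrib flip: D_def)
  also have "\<dots> \<le> (norm x - norm y)\<^sup>2 / D + 2 * (norm x * norm y - x \<bullet> y) / D"
    using D by (intro add_right_mono divide_left_mono) (auto simp: power2_eq_square)
  also have "\<dots> = (dist x y)\<^sup>2 / D"
    by (simp add: dist_square_norm_inner add_divide_distrib)
  also have "\<dots> < (dist x y)\<^sup>2"
    using D assms by (simp add: divide_less_eq)
  finally show ?thesis
    by (rule power_less_imp_less_base) simp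
qed

lemma shrink_polar: "0 \<le> r \<Longrightarrow> shrink (polar r a) = polar (r / (1 + 2 * r)) a"
  by (simp add: shrink_def scaleR_polar)

lemma shrink_polar_inverse_radius:
  assumes "0 < q"
  shows "shrink (polar (1 / q) a) = polar (1 / (q + 2)) a"
proof -
  have "1 / q / (1 + 2 * (1 / q)) = 1 / (q + 2)"
    using assms by (simp add: field_simps)
  then show ?thesis
    using assms by (simp add: shrink_polar)
qed

lemma snake_angle_add_2 [simp]: "snake_angle (n + 2) = snake_angle n" "snake_angle (Suc (Suc n)) = snake_angle n"
  by (simp_all add: snake_angle_def)

lemma snake_segment_inverse_radius:
  assumes "n \<ge> 1" "1 / (real n + 1) \<le> r" "r \<le> 1 / real n"
  obtains q where "r = 1 / q" "real n \<le> q" "q \<le> real n + 1"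
proof
  have "0 < 1 / (real n + 1)" by simp
  then have "0 < r" using assms by linarith
  then show "r = 1 / (1 / r)" "real n \<le> 1 / r" "1 / r \<le> real n + 1"
    using assms by (auto simp: field_simps)
qed

lemma polar_inverse_in_snake_I:
  assumes "n \<ge> 1" "real n \<le> q" "q \<le> real n + 1"
  shows "polar (1 / q) (snake_angle n) \<in> snake"
  using assms by (intro polar_in_snake_I) (auto intro!: divide_left_mono)

lemma shrink_in_snake:
  assumes "x \<in> snake"
  shows "shrink x \<in> snake"
  using assms
proof (cases rule: snake_cases)
  case zero
  then show ?thesis by (simp add: shrink_def)
next
  case (arc n a)
  have "shrink x = polar (1 / real (n + 2)) a"
    using arc(1) unfolding arc(4) by (subst shrink_polar_inverse_radius) (auto simp: add.commute)
  then show ?thesis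
    using polar_in_snake_O[of "n + 2" a] arc by simp
next
  case (radial n r)
  obtain q where q: "r = 1 / q" "real n \<le> q" "q \<le> real n + 1"
    using radial snake_segment_inverse_radius by blast
  have "shrink x = polar (1 / (q + 2)) (snake_angle (n + 2))"
    using radial q by (simp add: shrink_polar_inverse_radius)
  then show ?thesis
    using polar_inverse_in_snake_I[of "n + 2" "q + 2"] q radial(1) by simp
qed

section \<open>Lipschitz paths for the two outermost arcs and segments\<close>

definition segment_piece :: "nat \<Rightarrow> real \<Rightarrow> real ^ 2" where
  "segment_piece n t = polar (1 / (real n + 1) + t * (1 / real n - 1 / (real n + 1))) (snake_angle n)"

text \<open>A tenth of an arc. Ten pieces bring the Lipschitz constant down from
  \<open>3 * pi / 2\<close> to \<open>3 * pi / 20\<close>, which is below \<open>1\<close> by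
  \<open>pi < 4\<close>.\<close>

definition arc_piece :: "nat \<Rightarrow> nat \<Rightarrow> real \<Rightarrow> real ^ 2" where
  "arc_piece n k t = polar (1 / real n) (pi / 2 + 3 * pi / 20 * (real k + t))"

lemma segment_piece_in_snake:
  assumes "n \<ge> 1" "0 \<le> t" "t \<le> 1"
  shows "segment_piece n t \<in> snake"
  unfolding segment_piece_def
proof (rule polar_in_snake_I)
  have "1 / (real n + 1) \<le> 1 / real n"
    using assms by (intro divide_left_mono) auto
  then have "0 \<le> t * (1 / real n - 1 / (real n + 1))"
    and "t * (1 / real n - 1 / (real n + 1)) \<le> 1 / real n - 1 / (real n + 1)"
    using assms by (auto intro!: mult_left_le_one_le)
  then show "1 / (real n + 1) \<le> 1 / (real n + 1) + t * (1 / real n - 1 / (real n + 1))"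
    "1 / (real n + 1) + t * (1 / real n - 1 / (real n + 1)) \<le> 1 / real n"
    by linarith+
qed (use assms in auto)

lemma segment_piece_surj:
  assumes "n \<ge> 1" "1 / (real n + 1) \<le> r" "r \<le> 1 / real n"
  obtains t where "0 \<le> t" "t \<le> 1" "polar r (snake_angle n) = segment_piece n t"
proof
  define D where "D = 1 / real n - 1 / (real n + 1)"
  define t where "t = (r - 1 / (real n + 1)) / D"
  have "1 / (real n + 1) < 1 / real n"
    using assms by (intro divide_strict_left_mono) auto
  then have D: "0 < D" by (simp add: D_def)
  show "0 \<le> t"
    using D assms by (simp add: t_def)
  show "t \<le> 1"
    unfolding t_def using D assms by (simp add: divide_le_eq) (simp add: D_def)
  have "t * D = r - 1 / (real n + 1)"
    using D by (simp add: t_def)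
  then show "polar r (snake_angle n) = segment_piece n t"
    by (simp add: segment_piece_def flip: D_def)
qed

lemma dist_segment_piece:
  assumes "n \<ge> 1"
  shows "dist (segment_piece n s) (segment_piece n t) = (1 / real n - 1 / (real n + 1)) * \<bar>s - t\<bar>"
proof -
  have "0 \<le> 1 / real n - 1 / (real n + 1)"
    using assms by (simp add: divide_left_mono)
  then show ?thesis
    by (simp add: segment_piece_def dist_polar_same_angle abs_mult flip: left_diff_distrib)
qed

lemma dist_segment_piece_le:
  assumes "n \<ge> 1"
  shows "dist (segment_piece n s) (segment_piece n t) \<le> 1 / 2 * \<bar>s - t\<bar>"
proof -
  define D where "D = 1 / real n - 1 / (real n + 1)"
  have "D = 1 / (real n * (real n + 1))"
    using assms by (simp add: D_def field_simps)
  moreover have "1 * 2 \<le> real n * (real n + 1)"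
    using assms by (intro mult_mono) auto
  ultimately have D: "0 \<le> D" "D \<le> 1 / 2"
    by (auto intro: frac_le[where y = 1, simplified])
  then show ?thesis
    unfolding dist_segment_piece[OF assms] D_def[symmetric] by (intro mult_right_mono) auto
qed

lemma arc_piece_in_snake:
  assumes "n \<ge> 1" "k < 10" "0 \<le> t" "t \<le> 1"
  shows "arc_piece n k t \<in> snake"
  unfolding arc_piece_def
proof (rule polar_in_snake_O)
  have "real k \<le> real 9"
    using assms(2) by (intro of_nat_mono) simp
  then have "3 * pi / 20 * (real k + t) \<le> 3 * pi / 20 * 10"
    using assms by (intro mult_left_mono) auto
  moreover have "pi / 2 + 3 * pi / 20 * 10 = 2 * pi"
    by simp
  ultimately show "pi / 2 + 3 * pi / 20 * (real k + t) \<le> 2 * pi"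
    by linarith
qed (use assms in auto)

lemma arc_piece_surj:
  assumes "pi / 2 \<le> a" "a \<le> 2 * pi"
  obtains k t where "k < 10" "0 \<le> t" "t \<le> 1" "polar (1 / real n) a = arc_piece n k t"
proof -
  define s where "s = (a - pi / 2) / (3 * pi / 20)"
  have s: "0 \<le> s" "s \<le> 10" "a = pi / 2 + 3 * pi / 20 * s"
    using assms by (auto simp: s_def field_simps)
  \<comment> \<open>The end \<open>s = 10\<close> belongs to the last piece, whose number is
    \<open>9\<close>; rounding down would give \<open>10\<close>.\<close>
  define k where "k = (if s = 10 then 9 else nat \<lfloor>s\<rfloor>)"
  have "k < 10 \<and> real k \<le> s \<and> s \<le> real k + 1"
    using s unfolding k_def by (cases "s = 10") (simp, simp, linarith)
  then show ?thesis
    using that[of k "s - real k"] s(3) by (simp add: arc_piece_def)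
qed

lemma dist_arc_piece_le:
  assumes "n \<ge> 1"
  shows "dist (arc_piece n k s) (arc_piece n k t) \<le> 3 * pi / 20 * \<bar>s - t\<bar>"
proof -
  have "pi / 2 + 3 * pi / 20 * (real k + s) - (pi / 2 + 3 * pi / 20 * (real k + t)) =
      3 * pi / 20 * (s - t)"
    by (simp add: field_simps)
  then have "dist (arc_piece n k s) (arc_piece n k t) \<le> 1 / real n * \<bar>3 * pi / 20 * (s - t)\<bar>"
    unfolding arc_piece_def by (metis dist_polar_same_radius_le of_nat_0_le_iff zero_le_divide_1_iff)
  also have "\<dots> \<le> 1 * \<bar>3 * pi / 20 * (s - t)\<bar>"
    using assms by (intro mult_right_mono) auto
  finally show ?thesis
    by (simp add: abs_mult)
qed

lemma weak_contraction_shrink: "weak_contraction snake_metric shrink"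
  by (simp add: weak_contraction_def shrink_in_snake dist_shrink_less)

lemma weak_contraction_path_norm:
  assumes "\<And>t. 0 \<le> t \<Longrightarrow> t \<le> 1 \<Longrightarrow> g t \<in> snake"
    and lip: "\<And>s t. dist (g s) (g t) \<le> K * \<bar>s - t\<bar>" and K: "0 \<le> K" "K < 1"
  shows "weak_contraction snake_metric (\<lambda>x. g (norm x))"
proof -
  have "dist (g (norm x)) (g (norm y)) < dist x y" if "x \<noteq> y" for x y :: "real ^ 2"
  proof -
    have "dist (g (norm x)) (g (norm y)) \<le> K * \<bar>norm x - norm y\<bar>"
      by (rule lip)
    also have "\<dots> \<le> K * dist x y"
      using K by (intro mult_left_mono) (auto simp: dist_norm norm_triangle_ineq3)
    also have "\<dots> < dist x y"
      using K that by simp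
    finally show ?thesis .
  qed
  then show ?thesis
    using assms(1) norm_snake_le by (auto simp: weak_contraction_def)
qed

text \<open>\<open>shrink\<close> raises the index by two, so it reaches the origin and every arc
  and segment of index at least \<open>3\<close>; the pieces supply the indices \<open>1\<close> and
  \<open>2\<close>.\<close>

definition snake_weak_IFS :: "(real ^ 2 \<Rightarrow> real ^ 2) set" where
  "snake_weak_IFS = insert shrink
    ((\<lambda>n x. segment_piece n (norm x)) ` {1, 2} \<union>
     (\<lambda>(n, k) x. arc_piece n k (norm x)) ` ({1, 2} \<times> {..<10}))"

lemma weak_IFS_snake: "weak_IFS snake_metric snake_weak_IFS"
proof -
  have "weak_contraction snake_metric (\<lambda>x. segment_piece n (norm x))" if "n \<ge> 1" for n
    using that
    by (intro weak_contraction_path_norm[where K = "1 / 2"] segment_piece_in_snake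
        dist_segment_piece_le) auto
  moreover have "weak_contraction snake_metric (\<lambda>x. arc_piece n k (norm x))"
    if "n \<ge> 1" "k < 10" for n k
    using that pi_less_4
    by (intro weak_contraction_path_norm[where K = "3 * pi / 20"] arc_piece_in_snake
        dist_arc_piece_le) auto
  ultimately show ?thesis
    by (auto simp: weak_IFS_def snake_weak_IFS_def weak_contraction_shrink)
qed

lemma snake_eq_Union_snake_weak_IFS: "snake = (\<Union>f\<in>snake_weak_IFS. f ` snake)"
proof
  show "(\<Union>f\<in>snake_weak_IFS. f ` snake) \<subseteq> snake"
    using weak_IFS_snake by (auto simp: weak_IFS_def weak_contraction_def Pi_iff)
  have segment: "segment_piece n t \<in> (\<Union>f\<in>snake_weak_IFS. f ` snake)"
    if asm: "n \<in> {1, 2}" "0 \<le> t" "t \<le> 1" for n t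
  proof -
    obtain y where y: "y \<in> snake" "norm y = t"
      using ex_snake_norm asm(2,3) by blast
    have "(\<lambda>x. segment_piece n (norm x)) \<in> snake_weak_IFS"
      unfolding snake_weak_IFS_def using asm(1) by blast
    then show ?thesis
      using y by blast
  qed
  have arc: "arc_piece n k t \<in> (\<Union>f\<in>snake_weak_IFS. f ` snake)"
    if asm: "n \<in> {1, 2}" "k < 10" "0 \<le> t" "t \<le> 1" for n k t
  proof -
    obtain y where y: "y \<in> snake" "norm y = t"
      using ex_snake_norm asm(3,4) by blast
    have "(n, k) \<in> {1, 2} \<times> {..<10}"
      using asm(1,2) by simp
    then have "(\<lambda>x. arc_piece n k (norm x)) \<in> snake_weak_IFS"
      unfolding snake_weak_IFS_def by force
    then show ?thesis
      using y by blast
  qed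
  have shrink: "shrink y \<in> (\<Union>f\<in>snake_weak_IFS. f ` snake)" if "y \<in> snake" for y
    using that by (auto simp: snake_weak_IFS_def)
  show "snake \<subseteq> (\<Union>f\<in>snake_weak_IFS. f ` snake)"
  proof
    fix x assume "x \<in> snake"
    then show "x \<in> (\<Union>f\<in>snake_weak_IFS. f ` snake)"
    proof (cases rule: snake_cases)
      case zero
      then have "x = shrink 0" by (simp add: shrink_def)
      then show ?thesis using shrink[of 0] by simp
    next
      case n: (arc n a)
      show ?thesis
      proof (cases "n \<in> {1, 2}")
        case True
        obtain k t where "k < 10" "0 \<le> t" "t \<le> 1" "polar (1 / real n) a = arc_piece n k t"
          using arc_piece_surj n(2,3) by blast
        then show ?thesis
          using arc True n(4) by simp
      next
        case False
        define m where "m = n - 2"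
        have m: "n = m + 2" "m \<ge> 1"
          using False n(1) by (auto simp: m_def)
        have "x = shrink (polar (1 / real m) a)"
          using m n(4) by (subst shrink_polar_inverse_radius) (auto simp: add.commute)
        then show ?thesis
          using shrink polar_in_snake_O m n(2,3) by simp
      qed
    next
      case n: (radial n r)
      show ?thesis
      proof (cases "n \<in> {1, 2}")
        case True
        obtain t where "0 \<le> t" "t \<le> 1" "polar r (snake_angle n) = segment_piece n t"
          using segment_piece_surj n(1-3) by blast
        then show ?thesis
          using segment True n(4) by simp
      next
        case False
        define m where "m = n - 2"
        have m: "n = m + 2" "m \<ge> 1"
          using False n(1) by (auto simp: m_def)
        obtain q where q: "r = 1 / q" "real n \<le> q" "q \<le> real n + 1"
          using n snake_segment_inverse_radius by blast
        have "x = shrink (polar (1 / (q - 2)) (snake_angle m))"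
          using m n(4) q by (subst shrink_polar_inverse_radius) auto
        then show ?thesis
          using shrink polar_inverse_in_snake_I[of m "q - 2"] m q by simp
      qed
    qed
  qed
qed

text \<open>The snake itself serves as the ambient space, embedded by the identity.\<close>

lemma weak_IFS_attractor_snake: "weak_IFS_attractor TYPE(real ^ 2) snake_metric"
proof -
  have "attractor snake_metric snake_weak_IFS snake"
    unfolding attractor_def
  proof (intro conjI)
    show "snake \<noteq> {}"
      using zero_in_snake by blast
    show "compactin (mtopology_of snake_metric) snake"
      using compact_space_snake by (simp add: compact_space_def)
  qed (rule snake_eq_Union_snake_weak_IFS)
  then have attr: "attractor snake_metric snake_weak_IFS (id ` mspace snake_metric)"
    by simp
  have emb: "isometric_embedding snake_metric snake_metric id"
    by (simp add: isometric_embedding_def)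
  show ?thesis
    unfolding weak_IFS_attractor_def
    by (intro conjI exI[of _ snake_metric] exI[of _ snake_weak_IFS] exI[of _ id]
        compact_space_snake emb weak_IFS_snake attr)
qed

section \<open>The snake is a Banach fractal\<close>

lemma mcomplete_of_euclidean_metric: "mcomplete_of (euclidean_metric :: 'c :: banach metric)"
  by (simp add: mcomplete_of_def complete_UNIV)

definition halving_IFS :: "'c :: real_normed_vector \<Rightarrow> ('c \<Rightarrow> 'c) set" where
  "halving_IFS v = {\<lambda>x. (1 / 2) *\<^sub>R x, \<lambda>x. (1 / 2) *\<^sub>R (x + v)}"

lemma IFS_halving:
  fixes v :: "'c :: real_normed_vector"
  shows "IFS euclidean_metric (halving_IFS v)"
proof -
  have "contraction euclidean_metric (\<lambda>x. (1 / 2) *\<^sub>R (x + w))" for w :: 'c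
    unfolding contraction_def
    by (intro conjI exI[of _ "1 / 2"]) (auto simp: dist_norm simp flip: scaleR_diff_right)
  from this[of 0] this[of v] show ?thesis
    by (auto simp: IFS_def halving_IFS_def)
qed

lemma attractor_halving: "attractor euclidean_metric (halving_IFS v) (closed_segment 0 v)"
proof -
  have seg: "closed_segment 0 v = (\<lambda>t. t *\<^sub>R v) ` {0..1}"
    by (simp add: closed_segment_image_interval)
  have "(1 / 2) *\<^sub>R (t *\<^sub>R v) = (t / 2) *\<^sub>R v" "(1 / 2) *\<^sub>R (t *\<^sub>R v + v) = ((t + 1) / 2) *\<^sub>R v"
    for t
    by (simp_all add: scaleR_add_left scaleR_add_right add_divide_distrib)
  then have "(\<Union>f\<in>halving_IFS v. f ` closed_segment 0 v) =
      (\<lambda>t. t *\<^sub>R v) ` ((\<lambda>t. t / 2) ` {0..1} \<union> (\<lambda>t. (t + 1) / 2) ` {0..1})"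
    by (simp only: halving_IFS_def seg image_Un image_image UN_insert UN_empty Un_empty_right)
  also have "(\<lambda>t::real. t / 2) ` {0..1} \<union> (\<lambda>t. (t + 1) / 2) ` {0..1} = {0..1}"
  proof -
    have "t \<in> (\<lambda>t::real. t / 2) ` {0..1} \<union> (\<lambda>t. (t + 1) / 2) ` {0..1}"
      if "0 \<le> t" "t \<le> 1" for t
    proof (cases "t \<le> 1 / 2")
      case True
      then have "2 * t \<in> {0..1}" "t = (2 * t) / 2" using that by auto
      then show ?thesis by blast
    next
      case False
      then have "2 * t - 1 \<in> {0..1}" "t = (2 * t - 1 + 1) / 2" using that by auto
      then show ?thesis by blast
    qed
    then have "{0..1} \<subseteq> (\<lambda>t::real. t / 2) ` {0..1} \<union> (\<lambda>t. (t + 1) / 2) ` {0..1}"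
      by (meson atLeastAtMost_iff subsetI)
    moreover have "(\<lambda>t::real. t / 2) ` {0..1} \<union> (\<lambda>t. (t + 1) / 2) ` {0..1} \<subseteq> {0..1}"
      by auto
    ultimately show ?thesis
      by (rule antisym[rotated])
  qed
  finally have "closed_segment 0 v = (\<Union>f\<in>halving_IFS v. f ` closed_segment 0 v)"
    unfolding seg by (rule sym)
  moreover have "compactin (mtopology_of euclidean_metric) (closed_segment 0 v)"
    by simp
  ultimately show ?thesis
    unfolding attractor_def using ends_in_segment(1)[of 0 v] by blast
qed

lemma homeomorphic_imp_homeomorphic_space:
  assumes "A homeomorphic B"
  shows "top_of_set A homeomorphic_space top_of_set B"
proof -
  obtain f g where "homeomorphism A B f g"
    using assms homeomorphic_def by blast
  then have "homeomorphic_maps (top_of_set A) (top_of_set B) f g"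
    by (auto simp: homeomorphic_maps_def homeomorphism_def)
  then show ?thesis
    by (rule homeomorphic_maps_imp_homeomorphic_space)
qed

text \<open>Only the topology matters here, so a line segment, covered by its two half-size copies,
  can stand in for the snake.\<close>

lemma Banach_fractal_snake: "Banach_fractal TYPE(real ^ 2) (mtopology_of snake_metric)"
proof -
  define v where "v = polar 1 0"
  have "norm v \<noteq> 0"
    by (simp add: v_def)
  then have "inj_on (\<lambda>t. t *\<^sub>R v) {0..1::real}"
    by (auto intro: inj_onI)
  then have "{0..1::real} homeomorphic closed_segment 0 v"
    by (intro homeomorphic_compact[where f = "\<lambda>t. t *\<^sub>R v"])
      (auto simp: closed_segment_image_interval intro!: continuous_intros)
  then have "snake homeomorphic closed_segment 0 v"
    using snake_homeomorphic_interval homeomorphic_trans by blast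
  then have homeo: "mtopology_of snake_metric homeomorphic_space
      subtopology (mtopology_of euclidean_metric) (closed_segment 0 v)"
    by (simp add: mtopology_of_snake_metric homeomorphic_imp_homeomorphic_space)
  have metr: "metrizable_space (mtopology_of snake_metric)"
    by (simp add: mtopology_of_snake_metric metrizable_space_subtopology metrizable_space_euclidean)
  show ?thesis
    unfolding Banach_fractal_def
    by (intro conjI exI[of _ euclidean_metric] exI[of _ "halving_IFS v"]
        exI[of _ "closed_segment 0 v"] compact_space_snake metr mcomplete_of_euclidean_metric
        IFS_halving attractor_halving homeo)
qed

section \<open>The snake is not an IFS-attractor\<close>

text \<open>A bound on the covering number at scale \<open>e\<close>. The bound is a real number, so
  that length divided by \<open>e\<close> plus a rounding term can be used directly.\<close>

definition has_cover :: "real \<Rightarrow> real \<Rightarrow> 'c :: metric_space set \<Rightarrow> bool" where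
  "has_cover e B A \<longleftrightarrow> (\<exists>\<C>. finite \<C> \<and> real (card \<C>) \<le> B \<and> A \<subseteq> \<Union>\<C> \<and>
     (\<forall>C\<in>\<C>. \<forall>x\<in>C. \<forall>y\<in>C. dist x y \<le> e))"

lemma has_cover_mono:
  assumes "has_cover e B A" "A' \<subseteq> A" "B \<le> B'"
  shows "has_cover e B' A'"
proof -
  obtain \<C> where C: "finite \<C>" "real (card \<C>) \<le> B" "A \<subseteq> \<Union>\<C>"
      "\<forall>C\<in>\<C>. \<forall>x\<in>C. \<forall>y\<in>C. dist x y \<le> e"
    using assms(1) unfolding has_cover_def by blast
  have "real (card \<C>) \<le> B'" "A' \<subseteq> \<Union>\<C>"
    using C(2,3) assms(2,3) by simp_all
  then show ?thesis
    unfolding has_cover_def using C(1,4) by (intro exI[of _ \<C>] conjI)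
qed

lemma has_cover_Un:
  assumes "has_cover e B A" "has_cover e B' A'"
  shows "has_cover e (B + B') (A \<union> A')"
proof -
  obtain \<C> where C: "finite \<C>" "real (card \<C>) \<le> B" "A \<subseteq> \<Union>\<C>"
      "\<forall>C\<in>\<C>. \<forall>x\<in>C. \<forall>y\<in>C. dist x y \<le> e"
    using assms(1) unfolding has_cover_def by blast
  obtain \<D> where D: "finite \<D>" "real (card \<D>) \<le> B'" "A' \<subseteq> \<Union>\<D>"
      "\<forall>C\<in>\<D>. \<forall>x\<in>C. \<forall>y\<in>C. dist x y \<le> e"
    using assms(2) unfolding has_cover_def by blast
  have "real (card (\<C> \<union> \<D>)) \<le> B + B'"
    using card_Un_le[of \<C> \<D>] C(2) D(2) by linarith
  moreover have "finite (\<C> \<union> \<D>)" "A \<union> A' \<subseteq> \<Union>(\<C> \<union> \<D>)"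
      "\<forall>C\<in>\<C> \<union> \<D>. \<forall>x\<in>C. \<forall>y\<in>C. dist x y \<le> e"
    using C D by blast+
  ultimately show ?thesis
    unfolding has_cover_def by (intro exI[of _ "\<C> \<union> \<D>"] conjI)
qed

lemma has_cover_UN:
  assumes "finite I" "\<And>i. i \<in> I \<Longrightarrow> has_cover e (B i) (A i)"
  shows "has_cover e (\<Sum>i\<in>I. B i) (\<Union>i\<in>I. A i)"
  using assms
proof (induction I rule: finite_induct)
  case empty
  show ?case
    unfolding has_cover_def by (intro exI[of _ "{}"]) simp
next
  case (insert i I)
  have "has_cover e (B i + (\<Sum>i\<in>I. B i)) (A i \<union> (\<Union>i\<in>I. A i))"
    by (intro has_cover_Un insert) auto
  then show ?case
    using insert(1,2) by simp
qed

lemma has_cover_Lipschitz_path: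
  fixes g :: "real \<Rightarrow> 'c :: metric_space"
  assumes lip: "\<And>s t. dist (g s) (g t) \<le> K * \<bar>s - t\<bar>" and "0 \<le> K" "0 < e"
  shows "has_cover e (K / e + 1) (g ` {0..1})"
proof -
  \<comment> \<open>The least natural number strictly above \<open>K / e\<close>; parameter
    intervals of length \<open>1 / N\<close> then have images of diameter at most
    \<open>e\<close>.\<close>
  define N where "N = nat \<lfloor>K / e\<rfloor> + 1"
  have "0 \<le> K / e"
    using assms by simp
  then have N: "real N \<le> K / e + 1" "K / e < real N" "N > 0"
    unfolding N_def by linarith+
  have KN: "K * (1 / real N) \<le> e"
    using N assms by (simp add: field_simps)
  define C where "C i = g ` {real i / real N .. (real i + 1) / real N}" for i
  have "finite (C ` {..<N})" "real (card (C ` {..<N})) \<le> K / e + 1"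
    using N(1) card_image_le[of "{..<N}" C] by auto
  moreover have "g ` {0..1} \<subseteq> \<Union>(C ` {..<N})"
  proof
    fix x assume "x \<in> g ` {0..1}"
    then obtain t where t: "0 \<le> t" "t \<le> 1" "x = g t" by auto
    define i where "i = (if t = 1 then N - 1 else nat \<lfloor>t * real N\<rfloor>)"
    have "i < N \<and> real i \<le> t * real N \<and> t * real N \<le> real i + 1"
    proof (cases "t = 1")
      case True
      then show ?thesis using N(3) by (simp add: i_def of_nat_diff)
    next
      case False
      then have "0 \<le> t * real N" "t * real N < real N"
        using t N(3) by auto
      then show ?thesis using False unfolding i_def by (simp, linarith)
    qed
    then have "i < N" "x \<in> C i"
      using t N(3) by (auto simp: C_def field_simps)
    then show "x \<in> \<Union>(C ` {..<N})" by blast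
  qed
  moreover have "dist x y \<le> e" if asm: "x \<in> C i" "y \<in> C i" for x y i
  proof -
    obtain s t where st: "x = g s" "y = g t" "real i / real N \<le> s" "s \<le> (real i + 1) / real N"
      "real i / real N \<le> t" "t \<le> (real i + 1) / real N"
      using asm by (auto simp: C_def)
    have "(real i + 1) / real N = real i / real N + 1 / real N"
      by (simp add: add_divide_distrib)
    then have "\<bar>s - t\<bar> \<le> 1 / real N"
      using st by linarith
    then have "K * \<bar>s - t\<bar> \<le> K * (1 / real N)"
      using assms(2) by (intro mult_left_mono)
    then show ?thesis
      using lip[of s t] KN st(1,2) by simp
  qed
  ultimately show ?thesis
    unfolding has_cover_def by (intro exI[of _ "C ` {..<N}"] conjI ballI) auto
qed

text \<open>Pigeonhole on chosen preimages: two in the same set of the cover are at most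
  \<open>e\<close> apart, so their images are at most \<open>c * e\<close> apart.\<close>

lemma card_separated_le_cover:
  assumes cover: "has_cover e B A" and P: "P \<subseteq> f ` A"
    and sep: "\<And>p q. p \<in> P \<Longrightarrow> q \<in> P \<Longrightarrow> p \<noteq> q \<Longrightarrow> c * e < dist p q"
    and lip: "\<And>x y. x \<in> A \<Longrightarrow> y \<in> A \<Longrightarrow> dist (f x) (f y) \<le> c * dist x y" and c: "0 \<le> c"
  shows "real (card P) \<le> B"
proof -
  obtain \<C> where C: "finite \<C>" "real (card \<C>) \<le> B" "A \<subseteq> \<Union>\<C>"
    "\<forall>C\<in>\<C>. \<forall>x\<in>C. \<forall>y\<in>C. dist x y \<le> e"
    using cover unfolding has_cover_def by blast
  have "\<forall>p\<in>P. \<exists>x. x \<in> A \<and> f x = p"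
    using P by blast
  from bchoice[OF this] obtain x where x: "\<And>p. p \<in> P \<Longrightarrow> x p \<in> A" "\<And>p. p \<in> P \<Longrightarrow> f (x p) = p"
    by auto
  have "\<forall>p\<in>P. \<exists>D. D \<in> \<C> \<and> x p \<in> D"
    using x(1) C(3) by blast
  from bchoice[OF this] obtain D where D: "\<And>p. p \<in> P \<Longrightarrow> D p \<in> \<C>" "\<And>p. p \<in> P \<Longrightarrow> x p \<in> D p"
    by auto
  have "inj_on D P"
  proof (rule inj_onI, rule ccontr)
    fix p q assume pq: "p \<in> P" "q \<in> P" "D p = D q" "p \<noteq> q"
    have "dist p q \<le> c * dist (x p) (x q)"
      using lip[of "x p" "x q"] x pq by simp
    also have "\<dots> \<le> c * e"
      using C(4) D[OF pq(1)] D(2)[OF pq(2)] pq(3) c by (intro mult_left_mono) simp_all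
    finally show False
      using sep[OF pq(1,2,4)] by simp
  qed
  then have "card P \<le> card \<C>"
    using D(1) C(1) by (intro card_inj_on_le) auto
  then show ?thesis
    using C(2) by linarith
qed

text \<open>The arcs up to index \<open>n\<close> contribute the harmonic sum, the segment lengths
  telescope to less than \<open>1\<close>, and each of the \<open>2 * n\<close> curves costs one
  extra set for rounding.\<close>

lemma has_cover_snake_head:
  assumes "n \<ge> 1" "0 < e"
  shows "has_cover e ((3 * pi / 2 * harm n + 1) / e + 2 * real n) {x \<in> snake. 1 / real n \<le> norm x}"
proof -
  define O' where "O' j = (\<lambda>t. polar (1 / real j) (pi / 2 + 3 * pi / 2 * t)) ` {0..1}" for j
  define I' where "I' j = segment_piece j ` {0..1}" for j
  define B where "B j = 3 * pi / 2 * (1 / real j) / e + 1 + ((1 / real j - 1 / (real j + 1)) / e + 1)" for j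
  have "has_cover e (B j) (O' j \<union> I' j)" if "j \<in> {1..n}" for j
    unfolding B_def O'_def I'_def
  proof (intro has_cover_Un has_cover_Lipschitz_path)
    show "dist (segment_piece j s) (segment_piece j t) \<le> (1 / real j - 1 / (real j + 1)) * \<bar>s - t\<bar>"
      for s t
      using that by (simp add: dist_segment_piece)
    show "0 \<le> 1 / real j - 1 / (real j + 1)"
      using that by (simp add: divide_left_mono)
    have diff: "pi / 2 + 3 * pi / 2 * s - (pi / 2 + 3 * pi / 2 * t) = 3 * pi / 2 * (s - t)" for s t
      by (simp add: algebra_simps)
    show "dist (polar (1 / real j) (pi / 2 + 3 * pi / 2 * s)) (polar (1 / real j) (pi / 2 + 3 * pi / 2 * t))
        \<le> 3 * pi / 2 * (1 / real j) * \<bar>s - t\<bar>" for s t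
      using dist_polar_same_radius_le[of "1 / real j" "pi / 2 + 3 * pi / 2 * s" "pi / 2 + 3 * pi / 2 * t"]
      unfolding diff abs_mult by simp
  qed (use assms in auto)
  then have "has_cover e (\<Sum>j=1..n. B j) (\<Union>j\<in>{1..n}. O' j \<union> I' j)"
    by (intro has_cover_UN) auto
  moreover have "{x \<in> snake. 1 / real n \<le> norm x} \<subseteq> (\<Union>j\<in>{1..n}. O' j \<union> I' j)"
  proof
    fix x assume x: "x \<in> {x \<in> snake. 1 / real n \<le> norm x}"
    then have "x \<in> snake" by simp
    then show "x \<in> (\<Union>j\<in>{1..n}. O' j \<union> I' j)"
    proof (cases rule: snake_cases)
      case zero
      then show ?thesis using x assms by (simp add: divide_le_0_iff)
    next
      case (arc j a)
      then have "1 / real n \<le> 1 / real j"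
        using x by simp
      then have "j \<in> {1..n}"
        using arc(1) assms by (simp add: field_simps)
      moreover have "x \<in> O' j"
        using arc unfolding O'_def
        by (intro image_eqI[of _ _ "(a - pi / 2) / (3 * pi / 2)"]) (auto simp: field_simps)
      ultimately show ?thesis by blast
    next
      case (radial j r)
      then have "0 \<le> r"
        using order_trans[of 0 "1 / (real j + 1)" r] by simp
      then have "1 / real n \<le> 1 / real j"
        using x radial by simp
      then have "j \<in> {1..n}"
        using radial(1) assms by (simp add: field_simps)
      moreover obtain t where "0 \<le> t" "t \<le> 1" "polar r (snake_angle j) = segment_piece j t"
        using segment_piece_surj radial(1-3) by blast
      then have "x \<in> I' j"
        using radial(4) by (simp add: I'_def)
      ultimately show ?thesis by blast
    qed
  qed
  moreover have "(\<Sum>j=1..n. B j) \<le> (3 * pi / 2 * harm n + 1) / e + 2 * real n"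
  proof -
    have telescope: "(\<Sum>j=1..n. 1 / real j - 1 / (real j + 1)) = 1 - 1 / (real n + 1)"
      by (induction n) (auto simp: add.commute)
    have "B j = (3 * pi / 2 * inverse (real j) + (1 / real j - 1 / (real j + 1))) / e + 2" for j
      by (simp add: B_def add_divide_distrib inverse_eq_divide)
    then have "(\<Sum>j=1..n. B j) =
        (3 * pi / 2 * harm n + (\<Sum>j=1..n. 1 / real j - 1 / (real j + 1))) / e + 2 * real n"
      by (simp add: sum.distrib harm_def sum_distrib_left flip: sum_divide_distrib)
    also have "\<dots> \<le> (3 * pi / 2 * harm n + 1) / e + 2 * real n"
      unfolding telescope using assms by (intro add_right_mono divide_right_mono) auto
    finally show ?thesis .
  qed
  ultimately show ?thesis
    using has_cover_mono by blast
qed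

section \<open>Separated points on the arcs as lower bounds for length\<close>

lemma sin_ge_linear_near_0:
  fixes l :: real
  assumes "l < 1"
  obtains d where "0 < d" "\<And>x. 0 < x \<Longrightarrow> x < d \<Longrightarrow> l * x < sin x"
proof -
  have "((\<lambda>x. sin x / x) \<longlongrightarrow> 1) (at (0::real))"
    using DERIV_sin[of "0::real"] by (simp add: DERIV_def)
  then have "\<forall>\<^sub>F x in at 0. l < sin x / x"
    using assms by (rule order_tendstoD)
  then obtain d where "0 < d" "\<And>x. x \<noteq> 0 \<Longrightarrow> \<bar>x\<bar> < d \<Longrightarrow> l < sin x / x"
    by (auto simp: eventually_at)
  then show ?thesis
    by (intro that[of d]) (auto simp flip: pos_less_divide_eq)
qed

text \<open>The arcs exceed a half circle, so half-angles reach \<open>3 * pi / 4\<close>, where the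
  sine decreases. It still does not fall below its value at a small \<open>x\<close>, so neighbours
  realize the shortest chord.\<close>

lemma sin_le_sin_obtuse:
  assumes "0 \<le> x" "x \<le> pi / 4" "x \<le> y" "y \<le> 3 * pi / 4"
  shows "sin x \<le> sin y"
proof (cases "y \<le> pi / 2")
  case True
  then show ?thesis using assms by (intro sin_monotone_2pi_le) auto
next
  case False
  have "sin x \<le> sin (pi - y)"
    using assms False by (intro sin_monotone_2pi_le) auto
  then show ?thesis by simp
qed

text \<open>On radius \<open>1 / j\<close> the angular step \<open>j * d\<close> means arc length
  \<open>d\<close>. Counting starts at the included end \<open>2 * pi\<close>, and indices below the
  floor stay strictly above the excluded angle \<open>pi / 2\<close>.\<close>

definition arc_points :: "real \<Rightarrow> nat \<Rightarrow> (real ^ 2) set" where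
  "arc_points d j = (\<lambda>i. polar (1 / real j) (2 * pi - real i * (real j * d))) `
     {..<nat \<lfloor>3 * pi / 2 / (real j * d)\<rfloor>}"

lemma arc_points_subset:
  assumes "j \<ge> 1" "0 < d"
  shows "arc_points d j \<subseteq> snake_O j"
proof
  fix p assume "p \<in> arc_points d j"
  then obtain i where i: "i < nat \<lfloor>3 * pi / 2 / (real j * d)\<rfloor>"
    "p = polar (1 / real j) (2 * pi - real i * (real j * d))"
    by (auto simp: arc_points_def)
  have "real i < 3 * pi / 2 / (real j * d)"
    using i(1) by linarith
  then have "real i * (real j * d) < 3 * pi / 2"
    using assms by (simp add: pos_less_divide_eq)
  moreover have "0 \<le> real i * (real j * d)"
    using assms by simp
  ultimately show "p \<in> snake_O j"
    unfolding snake_O_def i(2) by (auto intro!: exI[of _ "2 * pi - real i * (real j * d)"])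
qed

lemma dist_arc_points:
  assumes j: "j \<ge> 1" "0 < d" and l: "l * (real j * d / 2) < sin (real j * d / 2)"
    and small: "real j * d / 2 \<le> pi / 4"
    and i: "i < nat \<lfloor>3 * pi / 2 / (real j * d)\<rfloor>" "i' < i"
  shows "l * d < dist (polar (1 / real j) (2 * pi - real i * (real j * d)))
    (polar (1 / real j) (2 * pi - real i' * (real j * d)))"
proof -
  \<comment> \<open>\<open>x\<close> is half the angular step and \<open>y\<close> half the angle
    between the two points, so their chord is \<open>2 / j * \<bar>sin y\<bar>\<close>.\<close>
  define x y where "x = real j * d / 2" and "y = (real i - real i') * x"
  have x: "0 < x" using j by (simp add: x_def)
  have "real i < 3 * pi / 2 / (real j * d)"
    using i(1) by linarith
  then have "real i * x < 3 * pi / 4"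
    using j by (simp add: x_def field_simps)
  moreover have "y \<le> real i * x"
    unfolding y_def using x by (intro mult_right_mono) auto
  moreover have "1 * x \<le> y"
    unfolding y_def using x i(2) by (intro mult_right_mono) auto
  ultimately have "x \<le> y" "y \<le> 3 * pi / 4"
    by linarith+
  then have "sin x \<le> sin y"
    using x small by (intro sin_le_sin_obtuse) (simp_all add: x_def)
  then have "2 / real j * (l * x) < 2 / real j * sin y"
    using l j by (intro mult_strict_left_mono) (auto simp: x_def)
  moreover have "2 / real j * (l * x) = l * d"
    using j by (simp add: x_def)
  moreover have "(2 * pi - real i * (real j * d) - (2 * pi - real i' * (real j * d))) / 2 = - y"
    by (simp add: y_def x_def algebra_simps diff_divide_distrib)
  then have "dist (polar (1 / real j) (2 * pi - real i * (real j * d)))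
      (polar (1 / real j) (2 * pi - real i' * (real j * d))) = 2 / real j * \<bar>sin y\<bar>"
    by (subst dist_polar_same_radius) auto
  moreover have "2 / real j * sin y \<le> 2 / real j * \<bar>sin y\<bar>"
    by (intro mult_left_mono) auto
  ultimately show ?thesis by linarith
qed

lemma arc_points_separated:
  assumes j: "j \<ge> 1" "0 < d" and l: "l * (real j * d / 2) < sin (real j * d / 2)"
    and small: "real j * d / 2 \<le> pi / 4"
    and "p \<in> arc_points d j" "q \<in> arc_points d j" "p \<noteq> q"
  shows "l * d < dist p q"
proof -
  obtain i i' where i: "i < nat \<lfloor>3 * pi / 2 / (real j * d)\<rfloor>" "i' < nat \<lfloor>3 * pi / 2 / (real j * d)\<rfloor>"
    and pq: "p = polar (1 / real j) (2 * pi - real i * (real j * d))"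
      "q = polar (1 / real j) (2 * pi - real i' * (real j * d))"
    using assms by (auto simp: arc_points_def)
  have "i < i' \<or> i' < i"
    using \<open>p \<noteq> q\<close> pq by (metis linorder_neqE_nat)
  then show ?thesis
    using dist_arc_points[OF j l small i(1), of i'] dist_arc_points[OF j l small i(2), of i]
    unfolding pq by (metis dist_commute)
qed

lemma card_arc_points:
  assumes j: "j \<ge> 1" "0 < d" and l: "l * (real j * d / 2) < sin (real j * d / 2)" "0 \<le> l"
    and small: "real j * d / 2 \<le> pi / 4"
  shows "3 * pi / 2 / d * (1 / real j) - 1 \<le> real (card (arc_points d j))"
proof -
  have "0 \<le> l * d"
    using l j by simp
  then have "inj_on (\<lambda>i. polar (1 / real j) (2 * pi - real i * (real j * d)))
      {..<nat \<lfloor>3 * pi / 2 / (real j * d)\<rfloor>}"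
    using dist_arc_points[OF j l(1) small] by (intro linorder_inj_onI') fastforce+
  then have "card (arc_points d j) = nat \<lfloor>3 * pi / 2 / (real j * d)\<rfloor>"
    by (simp add: arc_points_def card_image)
  then have "3 * pi / 2 / (real j * d) - 1 \<le> real (card (arc_points d j))"
    by linarith
  moreover have "3 * pi / 2 / (real j * d) = 3 * pi / 2 / d * (1 / real j)"
    by simp
  ultimately show ?thesis
    by (simp only:)
qed

lemma norm_arc_points: "p \<in> arc_points d j \<Longrightarrow> norm p = 1 / real j"
  by (auto simp: arc_points_def)

text \<open>The gap between different circles; a scale below it separates points on different
  arcs.\<close>

lemma dist_inverse_nat:
  assumes "1 \<le> i" "i \<le> n" "1 \<le> j" "j \<le> n" "i \<noteq> j"
  shows "1 / (real n)\<^sup>2 \<le> \<bar>1 / real i - 1 / real j\<bar>"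
proof -
  have "real i * real j \<le> real n * real n"
    using assms by (intro mult_mono) auto
  then have "1 / (real n)\<^sup>2 \<le> 1 / (real i * real j)"
    using assms by (intro divide_left_mono) (auto simp: power2_eq_square)
  also have "\<dots> \<le> \<bar>real j - real i\<bar> / (real i * real j)"
    using assms by (intro divide_right_mono) (auto simp: abs_if)
  also have "\<dots> = \<bar>(real j - real i) / (real i * real j)\<bar>"
    by simp
  also have "(real j - real i) / (real i * real j) = 1 / real i - 1 / real j"
    using assms by (simp add: field_simps)
  finally show ?thesis .
qed

text \<open>The outer part of the snake up to the \<open>n\<close>-th arc has length \<open>L \<le> (3 \<pi> / 2) harm n + 1\<close>, so
  its image has length at most \<open>c L\<close>, while the arcs \<open>m\<close> to \<open>n\<close> have total length at least
  \<open>(3 \<pi> / 2) harm n - C\<close>. Length is measured by counting \<open>\<epsilon>\<close>-separated points.\<close>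

lemma contraction_not_onto_arcs:
  fixes f :: "real ^ 2 \<Rightarrow> real ^ 2"
  assumes lip: "\<And>x y. x \<in> snake \<Longrightarrow> y \<in> snake \<Longrightarrow> dist (f x) (f y) \<le> c * dist x y"
    and c: "0 \<le> c" "c < 1" and m: "m \<ge> 1"
    and onto: "\<And>n j. m \<le> j \<Longrightarrow> j \<le> n \<Longrightarrow> snake_O j \<subseteq> f ` {x \<in> snake. 1 / real n \<le> norm x}"
  shows False
proof -
  \<comment> \<open>The factor \<open>c\<close> is split as \<open>l * k\<close> with both factors
    below \<open>1\<close>: \<open>l\<close> pays for replacing arc length by chords, and
    \<open>k\<close> remains as the gain. With spacing \<open>d = k * e\<close> along the arcs,
    chords exceed \<open>l * d = c * e\<close>.\<close>
  define k l where "k = (1 + c) / 2" and "l = c / k"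
  have k: "c < k" "0 < k" "k < 1"
    using c by (auto simp: k_def)
  then have l: "0 \<le> l" "l < 1" "l * k = c"
    using c by (auto simp: l_def)
  obtain d0 where d0: "0 < d0" "\<And>x. 0 < x \<Longrightarrow> x < d0 \<Longrightarrow> l * x < sin x"
    using sin_ge_linear_near_0 l(2) by blast
  define C :: real where "C = (\<Sum>j=1..<m. 1 / real j)"
  \<comment> \<open>Solved from the final inequality. \<open>C\<close> accounts for the arcs before
    \<open>m\<close>; the \<open>2\<close> is \<open>1\<close> for the segments plus
    \<open>1\<close> for all rounding errors.\<close>
  define Z where "Z = (2 + 3 * pi / 2 * C) / ((1 - k) * (3 * pi / 2))"
  have "\<forall>\<^sub>F n in sequentially. Z < harm n"
    using harm_at_top by (simp add: filterlim_at_top_dense)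
  then have "\<forall>\<^sub>F n in sequentially. Z < harm n \<and> m \<le> n"
    using eventually_ge_at_top[of m] by eventually_elim auto
  then obtain n where n: "Z < harm n" "m \<le> n"
    by (auto simp: eventually_sequentially)
  \<comment> \<open>The first bound keeps \<open>e\<close> below the gap between circles and the
    rounding errors \<open>3 * n * e\<close> below \<open>1\<close>; the second puts all half-steps
    in the range of the sine estimate.\<close>
  define e where "e = min (1 / (3 * (real n)\<^sup>2)) (d0 / real n)"
  have n1: "1 \<le> real n" using n m by linarith
  have e: "0 < e" "e < 1 / (real n)\<^sup>2" "real n * e \<le> d0" "3 * real n * e \<le> 1"
  proof -
    show "0 < e"
      using n1 d0(1) by (simp add: e_def)
    have "e \<le> 1 / (3 * (real n)\<^sup>2)" "e \<le> d0 / real n"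
      by (auto simp: e_def)
    moreover have "1 / (3 * (real n)\<^sup>2) < 1 / (real n)\<^sup>2"
      using n1 by (simp add: field_simps)
    ultimately show "e < 1 / (real n)\<^sup>2"
      by linarith
    show "real n * e \<le> d0"
      using \<open>e \<le> d0 / real n\<close> n1 by (simp add: pos_le_divide_eq mult.commute)
    have "3 * real n * e \<le> 3 * real n * (1 / (3 * (real n)\<^sup>2))"
      using \<open>e \<le> 1 / (3 * (real n)\<^sup>2)\<close> n1 by (intro mult_left_mono) auto
    also have "\<dots> = 1 / real n"
      using n1 by (simp add: power2_eq_square)
    also have "\<dots> \<le> 1"
      using n1 by simp
    finally show "3 * real n * e \<le> 1" .
  qed
  define d where "d = k * e"
  have d: "0 < d" "d < e"
    using k e by (auto simp: d_def)
  have small: "0 < real j * d / 2" "real j * d / 2 < d0" "real j * d / 2 \<le> pi / 4"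
    if "j \<in> {m..n}" for j
  proof -
    have "real j * d \<le> real n * e"
      using that d by (intro mult_mono) auto
    moreover have "0 < real j * d"
      using that m d by simp
    moreover have "3 * (real n * e) \<le> 1"
      using e(4) by (simp only: mult.assoc)
    ultimately show "0 < real j * d / 2" "real j * d / 2 < d0" "real j * d / 2 \<le> pi / 4"
      using e(3) d0(1) pi_gt3 by linarith+
  qed
  note sin = d0(2)[OF small(1,2)]
  have sep: "c * e < dist p q"
    if p: "p \<in> arc_points d i" "i \<in> {m..n}" and q: "q \<in> arc_points d j" "j \<in> {m..n}"
      and "p \<noteq> q" for p q i j
  proof (cases "i = j")
    case True
    have "l * d < dist p q"
      using arc_points_separated[of j d l p q] sin[of j] small[of j] that m d True by auto
    moreover have "l * d = c * e"
      using l(3) by (simp add: d_def mult.assoc[symmetric])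
    ultimately show ?thesis by simp
  next
    case False
    have "c * e \<le> 1 * e"
      using c e by (intro mult_right_mono) auto
    also have "\<dots> < 1 / (real n)\<^sup>2"
      using e by simp
    also have "\<dots> \<le> \<bar>norm p - norm q\<bar>"
      using dist_inverse_nat[of i n j] p q m False by (auto simp: norm_arc_points)
    also have "\<dots> \<le> dist p q"
      by (simp add: dist_norm norm_triangle_ineq3)
    finally show ?thesis .
  qed
  define P where "P = (\<Union>j\<in>{m..n}. arc_points d j)"
  have "real (card P) \<le> (3 * pi / 2 * harm n + 1) / e + 2 * real n"
  proof (rule card_separated_le_cover[where f = f and c = c])
    show "has_cover e ((3 * pi / 2 * harm n + 1) / e + 2 * real n) {x \<in> snake. 1 / real n \<le> norm x}"
      using has_cover_snake_head e n m by simp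
    show "P \<subseteq> f ` {x \<in> snake. 1 / real n \<le> norm x}"
      unfolding P_def
    proof (rule UN_least)
      fix j assume "j \<in> {m..n}"
      then have "arc_points d j \<subseteq> snake_O j" "snake_O j \<subseteq> f ` {x \<in> snake. 1 / real n \<le> norm x}"
        using m d(1) by (intro arc_points_subset onto; simp)+
      then show "arc_points d j \<subseteq> f ` {x \<in> snake. 1 / real n \<le> norm x}"
        by (rule order_trans)
    qed
    show "c * e < dist p q" if "p \<in> P" "q \<in> P" "p \<noteq> q" for p q
      using that sep unfolding P_def by blast
  qed (use lip c in auto)
  moreover have "card P = (\<Sum>j\<in>{m..n}. card (arc_points d j))"
    unfolding P_def
  proof (rule card_UN_disjoint)
    show "\<forall>i\<in>{m..n}. \<forall>j\<in>{m..n}. i \<noteq> j \<longrightarrow> arc_points d i \<inter> arc_points d j = {}"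
    proof (intro ballI impI, rule ccontr)
      fix i j assume ij: "i \<in> {m..n}" "j \<in> {m..n}" "i \<noteq> j"
        and "arc_points d i \<inter> arc_points d j \<noteq> {}"
      then obtain p where "p \<in> arc_points d i" "p \<in> arc_points d j"
        by blast
      then have "1 / real i = 1 / real j"
        using norm_arc_points by metis
      then show False
        using ij by simp
    qed
  qed (auto simp: arc_points_def)
  moreover have "(\<Sum>j\<in>{m..n}. 3 * pi / 2 / d * (1 / real j) - 1) \<le> (\<Sum>j\<in>{m..n}. real (card (arc_points d j)))"
    using m d l sin small by (intro sum_mono card_arc_points[where l = l]) auto
  moreover have "(\<Sum>j\<in>{m..n}. 3 * pi / 2 / d * (1 / real j) - 1) \<ge> 3 * pi / 2 / d * (harm n - C) - real n"
  proof -
    have "harm n = (\<Sum>j=1..<m. 1 / real j) + (\<Sum>j=m..n. 1 / real j)"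
      unfolding harm_def inverse_eq_divide using n m
      by (subst sum.union_disjoint[symmetric]) (auto intro!: sum.cong)
    then have "(\<Sum>j\<in>{m..n}. 3 * pi / 2 / d * (1 / real j) - 1) =
        3 * pi / 2 / d * (harm n - C) - real (card {m..n})"
      unfolding C_def sum_subtractf sum_distrib_left[symmetric] by simp
    moreover have "real (card {m..n}) \<le> real n"
      using m by simp
    ultimately show ?thesis by linarith
  qed
  ultimately have "3 * pi / 2 / d * (harm n - C) - real n \<le> (3 * pi / 2 * harm n + 1) / e + 2 * real n"
    by simp
  \<comment> \<open>Of the \<open>3 * n\<close>, two parts come from the cover and one from the
    floors in the point counts.\<close>
  then have "3 * pi / 2 / d * (harm n - C) \<le> (3 * pi / 2 * harm n + 1) / e + 3 * real n"
    by linarith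
  \<comment> \<open>Multiplication by \<open>d = k * e\<close> turns counts back into lengths and
    leaves the factor \<open>k\<close> on the side of the cover.\<close>
  then have "d * (3 * pi / 2 / d * (harm n - C)) \<le> d * ((3 * pi / 2 * harm n + 1) / e + 3 * real n)"
    using d by (intro mult_left_mono) auto
  moreover have "d * (3 * pi / 2 / d * (harm n - C)) = 3 * pi / 2 * (harm n - C)"
    using d by simp
  moreover have "d * ((3 * pi / 2 * harm n + 1) / e + 3 * real n) =
      k * (3 * pi / 2 * harm n + 1) + k * (3 * real n * e)"
    using e by (simp add: d_def field_simps)
  ultimately have "3 * pi / 2 * (harm n - C) \<le> k * (3 * pi / 2 * harm n + 1) + k * (3 * real n * e)"
    by (simp only:)
  moreover have "k * (3 * real n * e) \<le> 1 * 1"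
    using k e by (intro mult_mono) auto
  moreover have "k \<le> 1"
    using k by simp
  ultimately have "3 * pi / 2 * (harm n - C) \<le> k * (3 * pi / 2 * harm n) + 2"
    unfolding distrib_left by linarith
  then have "(1 - k) * (3 * pi / 2) * harm n \<le> 2 + 3 * pi / 2 * C"
    by (simp add: algebra_simps)
  moreover have "0 < (1 - k) * (3 * pi / 2)"
    using k by simp
  ultimately have "harm n \<le> Z"
    unfolding Z_def by (simp add: pos_le_divide_eq mult.commute)
  then show False
    using n by simp
qed

section \<open>A single contraction that covers a tail of the snake\<close>

text \<open>Pulled back to the interval, \<open>C\<close> contains everything between
  \<open>0\<close> and the parameter \<open>t\<close> of \<open>y\<close>. The rest of the snake,
  from \<open>t\<close> on, is compact and misses \<open>0\<close>, so it keeps a positive distance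
  from \<open>0\<close>.\<close>

lemma connected_subset_snake_contains_tail:
  assumes C: "C \<subseteq> snake" "connected C" "0 \<in> C" "y \<in> C" "y \<noteq> 0"
  obtains d where "0 < d" "\<And>x. x \<in> snake \<Longrightarrow> norm x < d \<Longrightarrow> x \<in> C"
proof -
  obtain h where h: "homeomorphism {0..1} snake snake_path h"
    using homeomorphism_snake_path by blast
  have path0: "snake_path 0 = 0"
    by (simp add: snake_path_def)
  have h_path: "h (snake_path t) = t" if "t \<in> {0..1}" for t
    using h that by (simp add: homeomorphism_def)
  have path_h: "snake_path (h x) = x" "h x \<in> {0..1}" if "x \<in> snake" for x
    using h that by (auto simp: homeomorphism_def)
  define t where "t = h y"
  have t: "t \<in> {0..1}" "t \<noteq> 0"
    using path_h[of y] C path0 by (auto simp: t_def)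
  have "continuous_on C h"
    using h C continuous_on_subset by (auto simp: homeomorphism_def)
  then have "connected (h ` C)"
    using C by (intro connected_continuous_image)
  moreover have "0 \<in> h ` C"
    using h_path[of 0] path0 C(3) by force
  ultimately have Icc: "{0..t} \<subseteq> h ` C"
    using C(4) by (intro connected_contains_Icc) (auto simp: t_def)
  have "compact (snake_path ` {t..1})"
    using t by (intro compact_continuous_image continuous_on_subset[OF continuous_on_snake_path]) auto
  moreover have "0 \<notin> snake_path ` {t..1}"
  proof
    assume "0 \<in> snake_path ` {t..1}"
    then obtain s where "s \<in> {t..1}" "snake_path s = snake_path 0"
      using path0 by auto
    then show False
      using t inj_onD[OF inj_on_snake_path, of s 0] by auto
  qed
  ultimately obtain d where d: "0 < d" "\<And>x. x \<in> snake_path ` {t..1} \<Longrightarrow> d \<le> dist 0 x"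
    using separate_point_closed[of "snake_path ` {t..1}" 0] compact_imp_closed by blast
  show ?thesis
  proof (rule that[OF d(1)])
    fix x assume x: "x \<in> snake" "norm x < d"
    have "h x \<notin> {t..1}"
      using d(2)[of x] x path_h[of x] by force
    then have "h x \<in> {0..t}"
      using path_h[of x] x by auto
    then obtain z where "z \<in> C" "h x = h z"
      using Icc by auto
    then show "x \<in> C"
      using path_h x C(1) by (metis subsetD)
  qed
qed

lemma connected_snake: "connected snake"
  using connected_continuous_image[OF continuous_on_snake_path] by (simp add: snake_path_image)

lemma snake_not_union_of_contractions:
  fixes G :: "(real ^ 2 \<Rightarrow> real ^ 2) set"
  assumes "finite G" and eq: "snake = (\<Union>g\<in>G. g ` snake)"
    and lip: "\<And>g. g \<in> G \<Longrightarrow> \<exists>c. 0 \<le> c \<and> c < 1 \<and>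
      (\<forall>x\<in>snake. \<forall>y\<in>snake. dist (g x) (g y) \<le> c * dist x y)"
  shows False
proof -
  have cont: "continuous_on snake g" if asm: "g \<in> G" for g
  proof -
    obtain c where "0 \<le> c" "\<forall>x\<in>snake. \<forall>y\<in>snake. dist (g x) (g y) \<le> c * dist x y"
      using lip asm by blast
    then have "c-lipschitz_on snake g"
      by (simp add: lipschitz_on_def)
    then show ?thesis
      by (rule lipschitz_on_continuous_on)
  qed
  \<comment> \<open>The images that miss \<open>0\<close>. They stay at a distance from
    \<open>0\<close>, so a nonzero point \<open>y\<close> close enough to \<open>0\<close> lies in
    an image that also contains \<open>0\<close>.\<close>
  define K where "K = (\<Union>g\<in>{g \<in> G. 0 \<notin> g ` snake}. g ` snake)"
  have "compact K"
    unfolding K_def using \<open>finite G\<close> cont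
    by (intro compact_UN compact_continuous_image compact_snake) auto
  moreover have "0 \<notin> K"
    by (auto simp: K_def)
  ultimately obtain d where d: "0 < d" "\<And>x. x \<in> K \<Longrightarrow> d \<le> dist 0 x"
    using separate_point_closed[of K 0] compact_imp_closed by blast
  obtain y where y: "y \<in> snake" "norm y = min (d / 2) 1"
    using ex_snake_norm[of "min (d / 2) 1"] d(1) by auto
  have "y \<in> (\<Union>g\<in>G. g ` snake)"
    using y(1) eq by (rule subst[rotated])
  then obtain g where g: "g \<in> G" "y \<in> g ` snake" by blast
  have "y \<notin> K"
    using d y by force
  then have "0 \<in> g ` snake"
    using g by (auto simp: K_def)
  moreover have "y \<noteq> 0"
    using y d(1) by auto
  moreover have g_sub: "g ` snake \<subseteq> snake"
    using eq g(1) by blast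
  moreover have "connected (g ` snake)"
    by (intro connected_continuous_image connected_snake cont g)
  ultimately obtain r where r: "0 < r" "\<And>x. x \<in> snake \<Longrightarrow> norm x < r \<Longrightarrow> x \<in> g ` snake"
    using connected_subset_snake_contains_tail g(2) by blast
  obtain c where c: "0 \<le> c" "c < 1"
    and g_lip: "\<And>x y. x \<in> snake \<Longrightarrow> y \<in> snake \<Longrightarrow> dist (g x) (g y) \<le> c * dist x y"
    using lip g(1) by blast
  \<comment> \<open>If \<open>g 0 \<noteq> 0\<close>, a point of norm at most \<open>1 / m\<close>
    is at least \<open>1 / m\<close> away from \<open>g 0\<close>, hence so is its preimage from
    \<open>0\<close>.\<close>
  define s where "s = (if g 0 = 0 then r else min r (norm (g 0) / 2))"
  have "0 < s"
    using r(1) by (simp add: s_def)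
  then obtain m where m: "m \<ge> 1" "1 / real m < s"
    by (metis One_nat_def Suc_leI ex_inverse_of_nat_less inverse_eq_divide)
  show False
  proof (rule contraction_not_onto_arcs[OF g_lip c m(1)])
    fix n j assume j: "m \<le> j" "j \<le> n"
    have jm: "1 / real n \<le> 1 / real j" "1 / real j \<le> 1 / real m" "1 / real n \<le> 1 / real m"
      using j m by (auto intro!: divide_left_mono)
    show "snake_O j \<subseteq> g ` {x \<in> snake. 1 / real n \<le> norm x}"
    proof
      fix z assume z: "z \<in> snake_O j"
      then have norm_z: "norm z = 1 / real j"
        by (auto simp: snake_O_def)
      have "z \<in> snake"
        using z snake_O_subset[of j] j m by auto
      moreover have "norm z < r"
        using norm_z m jm by (auto simp: s_def split: if_splits)
      ultimately obtain x where x: "x \<in> snake" "z = g x"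
        using r(2) by blast
      have "dist z (g 0) \<le> c * norm x"
        using g_lip[of x 0] x by (simp add: dist_norm)
      also have "\<dots> \<le> 1 * norm x"
        using c by (intro mult_right_mono) auto
      finally have le: "dist z (g 0) \<le> norm x" by simp
      have "1 / real n \<le> norm x"
      proof (cases "g 0 = 0")
        case True
        then show ?thesis using le norm_z jm by (simp add: dist_norm)
      next
        case False
        then have "2 * (1 / real m) \<le> norm (g 0)"
          using m by (simp add: s_def)
        moreover have "norm (g 0) \<le> norm z + dist z (g 0)"
          using norm_triangle_sub[of "g 0" z] by (simp add: dist_norm norm_minus_commute)
        ultimately show ?thesis using le norm_z jm by linarith
      qed
      then show "z \<in> g ` {x \<in> snake. 1 / real n \<le> norm x}"
        using x by blast
    qed
  qed
qed

text \<open>The contractions map the isometric copy into itself, so conjugation with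
  \<open>e\<close> yields self-maps of the snake with the same constants, whatever the ambient
  space.\<close>

lemma not_IFS_attractor_snake: "\<not> IFS_attractor TYPE('b) snake_metric"
proof
  assume "IFS_attractor TYPE('b) snake_metric"
  then obtain X :: "'b metric" and F e
    where emb: "isometric_embedding snake_metric X e" and F: "IFS X F"
      and attr: "attractor X F (e ` snake)"
    unfolding IFS_attractor_def by auto
  have e_in: "e x \<in> mspace X" if "x \<in> snake" for x
    using emb that by (auto simp: isometric_embedding_def)
  have dist_e: "mdist X (e x) (e y) = dist x y" if "x \<in> snake" "y \<in> snake" for x y
    using emb that by (auto simp: isometric_embedding_def)
  have "inj_on e snake"
    using dist_e e_in by (metis dist_eq_0_iff inj_onI mdist_zero)
  then have inv: "inv_into snake e (e x) = x" if "x \<in> snake" for x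
    using that by simp
  have eq: "e ` snake = (\<Union>f\<in>F. f ` e ` snake)"
    using attr by (simp only: attractor_def)
  define g where "g f = (\<lambda>x. inv_into snake e (f (e x)))" for f
  have g: "g f x \<in> snake" "e (g f x) = f (e x)" if "f \<in> F" "x \<in> snake" for f x
  proof -
    have "f (e x) \<in> e ` snake"
      using eq that by blast
    then show "g f x \<in> snake" "e (g f x) = f (e x)"
      by (auto simp: g_def inv_into_into f_inv_into_f)
  qed
  show False
  proof (rule snake_not_union_of_contractions)
    show "finite (g ` F)"
      using F by (simp add: IFS_def)
    show "snake = (\<Union>h\<in>g ` F. h ` snake)"
    proof
      show "(\<Union>h\<in>g ` F. h ` snake) \<subseteq> snake"
        using g by auto
      show "snake \<subseteq> (\<Union>h\<in>g ` F. h ` snake)"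
      proof
        fix x assume x: "x \<in> snake"
        then have "e x \<in> (\<Union>f\<in>F. f ` e ` snake)"
          using eq by blast
        then obtain f y where "f \<in> F" "y \<in> snake" "e x = f (e y)"
          by blast
        then have "x = g f y"
          using inv[OF x] by (simp add: g_def)
        then show "x \<in> (\<Union>h\<in>g ` F. h ` snake)"
          using \<open>f \<in> F\<close> \<open>y \<in> snake\<close> by blast
      qed
    qed
    fix h assume "h \<in> g ` F"
    then obtain f where f: "f \<in> F" "h = g f" by blast
    then obtain c where c: "0 \<le> c" "c < 1"
      "\<And>x y. x \<in> mspace X \<Longrightarrow> y \<in> mspace X \<Longrightarrow> mdist X (f x) (f y) \<le> c * mdist X x y"
      using F unfolding IFS_def contraction_def by blast
    have "dist (h x) (h y) \<le> c * dist x y" if "x \<in> snake" "y \<in> snake" for x y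
      using c(3)[of "e x" "e y"] that f g dist_e e_in by (metis (no_types))
    then show "\<exists>c. 0 \<le> c \<and> c < 1 \<and> (\<forall>x\<in>snake. \<forall>y\<in>snake. dist (h x) (h y) \<le> c * dist x y)"
      using c by blast
  qed
qed

theorem mainTheorem1:
  shows "snake homeomorphic {0..1::real} \<and>
         weak_IFS_attractor TYPE(real ^ 2) snake_metric \<and>
         Banach_fractal TYPE(real ^ 2) (mtopology_of snake_metric) \<and>
         \<not> IFS_attractor TYPE('b) snake_metric"
  using snake_homeomorphic_interval weak_IFS_attractor_snake Banach_fractal_snake
    not_IFS_attractor_snake by blast

end
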